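(* Let $a,b>0$, $\Omega=[0,a]\times[0,b]$, $\rho=(\rho_1,\rho_2)$ with $\rho_1,\rho_2>0$, $\varphi=(\varphi_1,\varphi_2)\in(0,1]\times(0,1]$, let $\mathcal F:\Omega\times\hat E_f\to\hat E_f$, and let $\xi_1:[0,a]\to\hat E_f$, $\xi_2:[0,b]\to\hat E_f$ be given functions for which $h(x,y)=\xi_1(x)+\big(\xi_2(y)\ominus\xi_1(0)\big)$ is defined on $\Omega$. Suppose there is a constant $R>0$ such that for all $\upsilon,\hat\upsilon\in C[\Omega,\hat E_f]$ and all $(x,y)\in\Omega$ $$\mathbb D\big(\mathcal F(x,y,\upsilon(x,y)),\mathcal F(x,y,\hat\upsilon(x,y))\big)\le R\,\mathbb D\big(\upsilon(x,y),\hat\upsilon(x,y)\big).$$ If $$\Xi=\frac{R}{\Gamma(\varphi_1+1)\Gamma(\varphi_2+1)}\left(\frac{a^{\rho_1}}{\rho_1}\right)^{\varphi_1}\left(\frac{b^{\rho_2}}{\rho_2}\right)^{\varphi_2}<1,$$ then the problem $${}^{C}\mathfrak D_{0^+}^{\varphi,\rho}\upsilon(x,y)=\mathcal F(x,y,\upsilon(x,y)),\qquad \upsilon(x,0)=\xi_1(x),\quad \upsilon(0,y)=\xi_2(y)$$ has a unique solution, in the sense that there is exactly one $\upsilon\in C[\Omega,\hat E_f]$ with $$\upsilon(x,y)=h(x,y)+\mathfrak I_{0^+}^{\varphi,\rho}\big[\mathcal F(x,y,\upsilon(x,y))\big]\quad\text{for all }(x,y)\in\Omega .$$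
   Context: Fuzzy numbers: $E_f$ is the set of maps $z:\mathbb R\to[0,1]$ that are normal ($z(x_0)=1$ for some $x_0$), fuzzy convex ($z(tx_1+(1-t)x_2)\ge\min\{z(x_1),z(x_2)\}$ for $t\in[0,1]$), upper semicontinuous and compactly supported. Level sets: $[z]^r=\{x: z(x)\ge r\}=[\underline z_r,\overline z_r]$ for $0<r\le1$, and $[z]^0$ is the closure of $\{x:z(x)>0\}$. $\hat E_f\subset E_f$ is the set of those $z$ for which $r\mapsto[z]^r$ is continuous on $[0,1]$ for the Hausdorff metric. Addition and real scalar multiplication are levelwise. The metric is $\mathbb D(p,q)=\sup_{0\le r\le1}\max\{|\underline p_r-\underline q_r|,|\overline p_r-\overline q_r|\}$. The Hukuhara difference $p\ominus q$ is the $w\in\hat E_f$ with $p=q+w$, if it exists. $C[\Omega,\hat E_f]$ is the set of continuous functions $\Omega\to(\hat E_f,\mathbb D)$. Mixed Katugampola fuzzy fractional integral: for $\upsilon$ fuzzy valued and integrable, $$\mathfrak I_{0^+}^{\varphi,\rho}\upsilon(x,y)=\frac{\rho_1^{1-\varphi_1}\rho_2^{1-\varphi_2}}{\Gamma(\varphi_1)\Gamma(\varphi_2)}\int_0^x\!\!\int_0^y\frac{s^{\rho_1-1}t^{\rho_2-1}}{(x^{\rho_1}-s^{\rho_1})^{1-\varphi_1}(y^{\rho_2}-t^{\rho_2})^{1-\varphi_2}}\,\upsilon(s,t)\,dt\,ds ,$$ the integral being taken levelwise on the endpoint functions $\underline\upsilon(s,t,r),\overline\upsilon(s,t,r)$;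 $\mathfrak I_{0^+}^{\varphi,\rho}[\mathcal F(x,y,\upsilon(x,y))]$ is this integral applied to $(s,t)\mapsto\mathcal F(s,t,\upsilon(s,t))$. ${}^{C}\mathfrak D_{0^+}^{\varphi,\rho}$ is the mixed fuzzy Caputo-Katugampola generalized-Hukuhara fractional derivative: ${}^{C}\mathfrak D_{0^+}^{\varphi,\rho}\upsilon(x,y)=\mathfrak D_{0^+}^{\varphi,\rho}\big(\upsilon(x,y)\ominus\upsilon(x,0)\ominus\upsilon(0,y)+\upsilon(0,0)\big)$, where $\mathfrak D_{0^+}^{\varphi,\rho}u(x,y)=x^{1-\rho_1}y^{1-\rho_2}\frac{\partial^2}{\partial x\partial y}\mathfrak I_{0^+}^{1-\varphi,\rho}u(x,y)$, $1-\varphi=(1-\varphi_1,1-\varphi_2)$, and partial derivatives are limits of difference quotients formed with the generalized Hukuhara difference ($p\ominus_{g\mathcal H}q=w$ iff $p=q+w$ or $q=p+(-1)w$). Convention: solutions of the problem are understood in the sense of the integral equation displayed in the claim.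
   Formalization: Added, since the claim fails e.g. for F=0 and discontinuous ξ1: the fractional integral of F(x,y,υ(x,y)) exists (levelwise Lebesgue) for every continuous υ, and the right-hand side h+I[F(x,y,υ0)] is continuous for at least one continuous υ0 (automatic for continuous F, ξ1, ξ2). *)

theory Defs
  imports "HOL-Analysis.Analysis"
begin

definition level :: "(real \<Rightarrow> real) \<Rightarrow> real \<Rightarrow> real set" where
  "level z r = (if r = 0 then closure {x. z x > 0} else {x. z x \<ge> r})"

definition lower_end :: "(real \<Rightarrow> real) \<Rightarrow> real \<Rightarrow> real" where
  "lower_end z r = Inf (level z r)"

definition upper_end :: "(real \<Rightarrow> real) \<Rightarrow> real \<Rightarrow> real" where
  "upper_end z r = Sup (level z r)"

definition fuzzy_numbers :: "(real \<Rightarrow> real) set" where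
  "fuzzy_numbers = {z.
     (\<forall>x. 0 \<le> z x \<and> z x \<le> 1) \<and>
     (\<exists>x0. z x0 = 1) \<and>
     (\<forall>x1 x2. \<forall>t\<in>{0..1}. z (t * x1 + (1 - t) * x2) \<ge> min (z x1) (z x2)) \<and>
     (\<forall>x c. z x < c \<longrightarrow> (\<forall>\<^sub>F y in at x. z y < c)) \<and>
     compact (closure {x. z x > 0})}"

text \<open>The Hausdorff distance, meaningful for nonempty bounded sets.\<close>
definition hausdorff_dist :: "real set \<Rightarrow> real set \<Rightarrow> real" where
  "hausdorff_dist A B = max (SUP x\<in>A. infdist x B) (SUP y\<in>B. infdist y A)"

definition fuzzy_hat :: "(real \<Rightarrow> real) set" where
  "fuzzy_hat = {z \<in> fuzzy_numbers.
     \<forall>r\<in>{0..1}. \<forall>e>0. \<exists>d>0. \<forall>r'\<in>{0..1}. \<bar>r' - r\<bar> < d \<longrightarrow>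
       hausdorff_dist (level z r') (level z r) < e}"

text \<open>The locale \<^locale>\<open>Metric_space\<close> asks for nonnegativity off the carrier as well, whence the
  value 0 for arguments that are not fuzzy numbers.\<close>
definition fuzzy_dist :: "(real \<Rightarrow> real) \<Rightarrow> (real \<Rightarrow> real) \<Rightarrow> real" where
  "fuzzy_dist p q =
     (if p \<in> fuzzy_numbers \<and> q \<in> fuzzy_numbers
      then SUP r\<in>{0..1}. max \<bar>lower_end p r - lower_end q r\<bar> \<bar>upper_end p r - upper_end q r\<bar>
      else 0)"

text \<open>A fuzzy number is determined by its level sets, so levelwise operations are definite
  descriptions.\<close>
definition fuzzy_add :: "(real \<Rightarrow> real) \<Rightarrow> (real \<Rightarrow> real) \<Rightarrow> real \<Rightarrow> real" where
  "fuzzy_add p q = (THE w. w \<in> fuzzy_numbers \<and>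
     (\<forall>r\<in>{0..1}. level w r = {x + y | x y. x \<in> level p r \<and> y \<in> level q r}))"

definition hdiff_exists :: "(real \<Rightarrow> real) \<Rightarrow> (real \<Rightarrow> real) \<Rightarrow> bool" where
  "hdiff_exists p q \<longleftrightarrow> (\<exists>w\<in>fuzzy_hat. p = fuzzy_add q w)"

definition hdiff :: "(real \<Rightarrow> real) \<Rightarrow> (real \<Rightarrow> real) \<Rightarrow> real \<Rightarrow> real" where
  "hdiff p q = (THE w. w \<in> fuzzy_hat \<and> p = fuzzy_add q w)"

text \<open>The space \<open>C[\<Omega>, fuzzy_hat]\<close>. Functions are taken to be \<^const>\<open>undefined\<close>
  outside \<open>\<Omega>\<close>, so that equality of elements is equality on \<open>\<Omega>\<close>.\<close>
definition fuzzy_cont :: "(real \<times> real) set \<Rightarrow> (real \<times> real \<Rightarrow> real \<Rightarrow> real) set" where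
  "fuzzy_cont \<Omega> = {v \<in> \<Omega> \<rightarrow>\<^sub>E fuzzy_hat.
     continuous_map (top_of_set \<Omega>) (Metric_space.mtopology fuzzy_hat fuzzy_dist) v}"

text \<open>The kernel and the double integral are evaluated on \<open>[0,x] \<times> [0,y]\<close> with Lebesgue
  measure; the conventions \<open>0 powr c = 0\<close> and division by zero only matter on the null set
  where \<open>s \<in> {0, x}\<close> or \<open>t \<in> {0, y}\<close>. Under the integrability condition below the double
  integral is the iterated one by Fubini.\<close>
definition kat_kernel ::
    "real \<Rightarrow> real \<Rightarrow> real \<Rightarrow> real \<Rightarrow> real \<Rightarrow> real \<Rightarrow> real \<Rightarrow> real \<Rightarrow> real" where
  "kat_kernel \<rho>1 \<rho>2 \<phi>1 \<phi>2 x y s t =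
     s powr (\<rho>1 - 1) * t powr (\<rho>2 - 1) /
     ((x powr \<rho>1 - s powr \<rho>1) powr (1 - \<phi>1) * (y powr \<rho>2 - t powr \<rho>2) powr (1 - \<phi>2))"

definition kat_integrable ::
    "real \<Rightarrow> real \<Rightarrow> real \<Rightarrow> real \<Rightarrow> (real \<times> real \<Rightarrow> real \<Rightarrow> real) \<Rightarrow> real \<Rightarrow> real \<Rightarrow> bool" where
  "kat_integrable \<rho>1 \<rho>2 \<phi>1 \<phi>2 g x y \<longleftrightarrow> (\<forall>r\<in>{0..1}.
     set_integrable lebesgue ({0..x} \<times> {0..y})
       (\<lambda>(s, t). kat_kernel \<rho>1 \<rho>2 \<phi>1 \<phi>2 x y s t * lower_end (g (s, t)) r) \<and>
     set_integrable lebesgue ({0..x} \<times> {0..y})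
       (\<lambda>(s, t). kat_kernel \<rho>1 \<rho>2 \<phi>1 \<phi>2 x y s t * upper_end (g (s, t)) r))"

definition kat_integral_real ::
    "real \<Rightarrow> real \<Rightarrow> real \<Rightarrow> real \<Rightarrow> (real \<times> real \<Rightarrow> real) \<Rightarrow> real \<Rightarrow> real \<Rightarrow> real" where
  "kat_integral_real \<rho>1 \<rho>2 \<phi>1 \<phi>2 f x y =
     \<rho>1 powr (1 - \<phi>1) * \<rho>2 powr (1 - \<phi>2) / (Gamma \<phi>1 * Gamma \<phi>2) *
     set_lebesgue_integral lebesgue ({0..x} \<times> {0..y})
       (\<lambda>(s, t). kat_kernel \<rho>1 \<rho>2 \<phi>1 \<phi>2 x y s t * f (s, t))"

definition kat_integral ::
    "real \<Rightarrow> real \<Rightarrow> real \<Rightarrow> real \<Rightarrow> (real \<times> real \<Rightarrow> real \<Rightarrow> real) \<Rightarrow> real \<Rightarrow> real \<Rightarrow>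
     real \<Rightarrow> real" where
  "kat_integral \<rho>1 \<rho>2 \<phi>1 \<phi>2 g x y = (THE w. w \<in> fuzzy_numbers \<and> (\<forall>r\<in>{0..1}. level w r =
     {kat_integral_real \<rho>1 \<rho>2 \<phi>1 \<phi>2 (\<lambda>p. lower_end (g p) r) x y ..
      kat_integral_real \<rho>1 \<rho>2 \<phi>1 \<phi>2 (\<lambda>p. upper_end (g p) r) x y}))"

text \<open>The metric on \<open>fuzzy_hat\<close> is a genuine one, so \<open>Metric_space.mtopology\<close> in
  \<^const>\<open>fuzzy_cont\<close> is the metric topology.\<close>

lemma level_fuzzy:
  assumes z: "z \<in> fuzzy_numbers" and r: "r \<in> {0..1}"
  shows "level z r \<noteq> {}" "level z r \<subseteq> level z 0" "compact (level z r)" "convex (level z r)"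
proof -
  from z obtain x0 where x0: "z x0 = 1" by (auto simp: fuzzy_numbers_def)
  have "x0 \<in> closure {x. z x > 0}" using x0 by (intro subsetD[OF closure_subset]) auto
  with x0 r have "x0 \<in> level z r" by (simp add: level_def)
  then show "level z r \<noteq> {}" by blast
  show sub: "level z r \<subseteq> level z 0"
  proof
    fix x assume x: "x \<in> level z r"
    show "x \<in> level z 0"
    proof (cases "r = 0")
      case False
      with x r have "x \<in> {x. z x > 0}" by (simp add: level_def)
      then have "x \<in> closure {x. z x > 0}" by (rule subsetD[OF closure_subset])
      then show ?thesis by (simp add: level_def)
    qed (use x in simp)
  qed
  have fc: "z (t * x1 + (1 - t) * x2) \<ge> min (z x1) (z x2)" if "0 \<le> t" "t \<le> 1" for t x1 x2
    using z that by (auto simp: fuzzy_numbers_def)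
  have cv: "convex {x. P (z x)}" if P: "\<And>u v. P u \<Longrightarrow> u \<le> v \<Longrightarrow> P v" for P
    unfolding convex_alt
  proof (intro ballI allI impI)
    fix x y u :: real assume "x \<in> {x. P (z x)}" "y \<in> {x. P (z x)}" "0 \<le> u \<and> u \<le> 1"
    then show "(1 - u) *\<^sub>R x + u *\<^sub>R y \<in> {x. P (z x)}"
      using fc[of u y x] P[of "min (z y) (z x)" "z (u * y + (1 - u) * x)"]
      by (auto simp: add.commute min_def split: if_splits)
  qed
  have "convex {x. z x > 0}" "convex {x. z x \<ge> r}"
    using cv[of "\<lambda>u. u > 0"] cv[of "\<lambda>u. u \<ge> r"] by auto
  then show "convex (level z r)" by (auto simp: level_def)
  have comp0: "compact (level z 0)" using z by (auto simp: level_def fuzzy_numbers_def)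
  have "closed {x. z x \<ge> r}"
  proof -
    have "open {x. z x < r}"
      unfolding open_dist
    proof
      fix x assume x: "x \<in> {x. z x < r}"
      then have "\<forall>\<^sub>F y in at x. z y < r" using z by (auto simp: fuzzy_numbers_def)
      then obtain d where d: "d > 0" "\<forall>y. y \<noteq> x \<and> dist y x < d \<longrightarrow> z y < r"
        by (auto simp: eventually_at)
      have "z y < r" if "dist y x < d" for y
        using that d(2) x by (cases "y = x") auto
      with d(1) show "\<exists>e>0. \<forall>y. dist y x < e \<longrightarrow> y \<in> {x. z x < r}" by blast
    qed
    moreover have "- {x. z x \<ge> r} = {x. z x < r}" by auto
    ultimately show ?thesis by (simp add: closed_def)
  qed
  then have "closed (level z r)" by (auto simp: level_def)
  then show "compact (level z r)"
    using comp0 sub by (metis compact_Int_closed inf.absorb2)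
qed

lemma level_fuzzy_eq:
  assumes z: "z \<in> fuzzy_numbers" and r: "r \<in> {0..1}"
  shows "level z r = {lower_end z r .. upper_end z r}" "lower_end z r \<le> upper_end z r"
proof -
  obtain a b where ab: "level z r = {a..b}"
    using level_fuzzy(3,4)[OF z r] connected_compact_interval_1 convex_connected by blast
  with level_fuzzy(1)[OF z r] have "a \<le> b" by auto
  with ab show "level z r = {lower_end z r .. upper_end z r}" "lower_end z r \<le> upper_end z r"
    by (auto simp: lower_end_def upper_end_def)
qed

lemma fuzzy_ends_bounds:
  assumes z: "z \<in> fuzzy_numbers" and r: "r \<in> {0..1}"
  shows "lower_end z 0 \<le> lower_end z r" "upper_end z r \<le> upper_end z 0"
  using level_fuzzy_eq[OF z r] level_fuzzy_eq[OF z, of 0] level_fuzzy(2)[OF z r] by auto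

lemma fuzzy_eqI:
  assumes p: "p \<in> fuzzy_numbers" and q: "q \<in> fuzzy_numbers"
    and eq: "\<And>r. r \<in> {0..1} \<Longrightarrow> level p r = level q r"
  shows "p = q"
proof
  have le: "u x \<le> v x" if u: "u \<in> fuzzy_numbers" and v: "v \<in> fuzzy_numbers"
    and uv: "\<And>r. r \<in> {0..1} \<Longrightarrow> level u r = level v r" for u v x
  proof (cases "u x = 0")
    case False
    then have "x \<in> level u (u x)" "u x \<in> {0..1}" using u by (auto simp: level_def fuzzy_numbers_def)
    with uv have "x \<in> level v (u x)" by blast
    with False show ?thesis by (simp add: level_def)
  qed (use v in \<open>auto simp: fuzzy_numbers_def\<close>)
  show "p x = q x" for x using le[OF p q, of x] le[OF q p, of x] eq by force
qed

lemma fuzzy_dist_le_iff: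
  assumes p: "p \<in> fuzzy_numbers" and q: "q \<in> fuzzy_numbers"
  shows "fuzzy_dist p q \<le> c \<longleftrightarrow> (\<forall>r\<in>{0..1}.
    \<bar>lower_end p r - lower_end q r\<bar> \<le> c \<and> \<bar>upper_end p r - upper_end q r\<bar> \<le> c)"
proof -
  let ?B = "\<bar>lower_end p 0\<bar> + \<bar>upper_end p 0\<bar> + \<bar>lower_end q 0\<bar> + \<bar>upper_end q 0\<bar>"
  have "max \<bar>lower_end p r - lower_end q r\<bar> \<bar>upper_end p r - upper_end q r\<bar> \<le> ?B"
    if r: "r \<in> {0..1}" for r
    using fuzzy_ends_bounds[OF p r] fuzzy_ends_bounds[OF q r]
      level_fuzzy_eq(2)[OF p r] level_fuzzy_eq(2)[OF q r] by linarith
  then have "bdd_above ((\<lambda>r. max \<bar>lower_end p r - lower_end q r\<bar>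
      \<bar>upper_end p r - upper_end q r\<bar>) ` {0..1})"
    by (intro bdd_aboveI2)
  then show ?thesis
    using p q by (simp add: fuzzy_dist_def cSUP_le_iff)
qed

lemma Metric_space_fuzzy_hat: "Metric_space fuzzy_hat fuzzy_dist"
proof
  have sub: "z \<in> fuzzy_numbers" if "z \<in> fuzzy_hat" for z using that by (simp add: fuzzy_hat_def)
  have pos: "0 \<le> fuzzy_dist p q" if p: "p \<in> fuzzy_numbers" and q: "q \<in> fuzzy_numbers" for p q
  proof -
    have "\<bar>lower_end p 0 - lower_end q 0\<bar> \<le> fuzzy_dist p q"
      using fuzzy_dist_le_iff[OF p q, of "fuzzy_dist p q"] by force
    then show ?thesis by linarith
  qed
  show "0 \<le> fuzzy_dist p q" for p q
    using pos[of p q] by (auto simp: fuzzy_dist_def)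
  show "fuzzy_dist p q = fuzzy_dist q p" for p q
    by (simp add: fuzzy_dist_def abs_minus_commute)
  show "fuzzy_dist p q = 0 \<longleftrightarrow> p = q" if "p \<in> fuzzy_hat" "q \<in> fuzzy_hat" for p q
  proof
    note pq = that[THEN sub]
    assume "fuzzy_dist p q = 0"
    then have "level p r = level q r" if "r \<in> {0..1}" for r
      using fuzzy_dist_le_iff[OF pq, of 0] level_fuzzy_eq(1)[OF pq(1) that]
        level_fuzzy_eq(1)[OF pq(2) that] that by auto
    then show "p = q" by (intro fuzzy_eqI pq)
  qed (simp add: fuzzy_dist_def)
  show "fuzzy_dist p w \<le> fuzzy_dist p q + fuzzy_dist q w"
    if "p \<in> fuzzy_hat" "q \<in> fuzzy_hat" "w \<in> fuzzy_hat" for p q w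
  proof -
    note s = that[THEN sub]
    show ?thesis
      unfolding fuzzy_dist_le_iff[OF s(1) s(3)]
      using fuzzy_dist_le_iff[OF s(1,2), of "fuzzy_dist p q"]
        fuzzy_dist_le_iff[OF s(2,3), of "fuzzy_dist q w"] by fastforce
  qed
qed

end

theory Submission
  imports Defs
begin

text \<open>
  The right-hand side \<open>T v = h + I[F v]\<close> of the integral equation is a contraction with factor \<open>\<Xi>\<close> for
  the supremum metric on the complete space \<open>C[\<Omega>, fuzzy_hat]\<close>: the kernel is nonnegative, its total mass
  over \<open>[0,x] \<times> [0,y]\<close> is explicit and increasing in \<open>(x, y)\<close>, and both endpoint functions of
  \<open>F v - F v'\<close> are bounded by \<open>R D(v, v')\<close> uniformly in the level.

  That \<open>T\<close> maps the space into itself has to be extracted from its doing so at one \<open>v0\<close>, since \<open>F\<close>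
  need not be continuous in \<open>(x, y)\<close>. The endpoint functions of \<open>T v\<close> and \<open>T v0\<close> differ by fractional
  integrals of functions bounded uniformly in the level, and such integrals are equicontinuous because
  the kernel depends continuously on \<open>(x, y)\<close> in \<open>L\<^sup>1\<close>; the latter is Scheffe's lemma.
\<close>

section \<open>Fuzzy numbers and their endpoint functions\<close>

lemma fuzzy_hat_D: "z \<in> fuzzy_hat \<Longrightarrow> z \<in> fuzzy_numbers"
  by (simp add: fuzzy_hat_def)

lemma level_antimono:
  assumes "z \<in> fuzzy_numbers" "0 \<le> r" "r \<le> r'" "r' \<le> 1"
  shows "level z r' \<subseteq> level z r"
proof (cases "r = 0")
  case True
  then show ?thesis using level_fuzzy(2)[OF assms(1), of r'] assms by auto
qed (use assms in \<open>auto simp: level_def\<close>)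

lemma ends_mono:
  assumes "z \<in> fuzzy_numbers" "0 \<le> r" "r \<le> r'" "r' \<le> 1"
  shows "lower_end z r \<le> lower_end z r'" "upper_end z r' \<le> upper_end z r"
  using level_antimono[OF assms] level_fuzzy_eq[OF assms(1), of r]
    level_fuzzy_eq[OF assms(1), of r'] assms by auto

lemma ends_of_level:
  assumes "level z r = {l..u}" "l \<le> u"
  shows "lower_end z r = l" "upper_end z r = u"
  using assms by (auto simp: lower_end_def upper_end_def)

lemma fuzzy_eqI_ends:
  assumes "p \<in> fuzzy_numbers" "q \<in> fuzzy_numbers"
    and "\<And>r. r \<in> {0..1} \<Longrightarrow> lower_end p r = lower_end q r"
    and "\<And>r. r \<in> {0..1} \<Longrightarrow> upper_end p r = upper_end q r"
  shows "p = q"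
  by (rule fuzzy_eqI) (use assms level_fuzzy_eq(1) in auto)

section \<open>Hausdorff distance of compact intervals\<close>

lemma infdist_interval_le:
  fixes a b c d x :: real
  assumes "x \<in> {a..b}" "c \<le> d"
  shows "infdist x {c..d} \<le> max \<bar>a - c\<bar> \<bar>b - d\<bar>"
proof -
  \<comment> \<open>The witness is \<open>x\<close> clamped to \<open>{c..d}\<close>, the point of
    that interval nearest to \<open>x\<close>.\<close>
  have "infdist x {c..d} \<le> dist x (max c (min x d))"
    by (rule infdist_le) (use assms in auto)
  also have "\<dots> \<le> max \<bar>a - c\<bar> \<bar>b - d\<bar>"
    using assms by (auto simp: dist_real_def max_def min_def abs_if split: if_splits)
  finally show ?thesis .
qed

lemma infdist_interval_ge:
  fixes c d x :: real
  assumes "c \<le> d"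
  shows "c - x \<le> infdist x {c..d}" "x - d \<le> infdist x {c..d}"
proof -
  have "infdist x {c..d} = (INF y\<in>{c..d}. dist x y)"
    using assms by (simp add: infdist_def)
  then show "c - x \<le> infdist x {c..d}" "x - d \<le> infdist x {c..d}"
    using assms by (auto intro!: cINF_greatest simp: dist_real_def)
qed

text \<open>Clamping bounds both one-sided excesses from above. From below, the excess of
  \<open>{a..b}\<close> over \<open>{c..d}\<close>, tested at \<open>a\<close> and at
  \<open>b\<close>, dominates \<open>c - a\<close> and \<open>b - d\<close>; the reverse excess
  dominates the same gaps with opposite signs, and together they give the absolute values.\<close>

lemma hausdorff_dist_interval:
  fixes a b c d :: real
  assumes "a \<le> b" "c \<le> d"
  shows "hausdorff_dist {a..b} {c..d} = max \<bar>a - c\<bar> \<bar>b - d\<bar>"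
proof (rule antisym)
  have le: "(SUP x\<in>{a..b}. infdist x {c..d}) \<le> max \<bar>a - c\<bar> \<bar>b - d\<bar>"
    if "a \<le> b" "c \<le> d" for a b c d :: real
    using that by (intro cSUP_least infdist_interval_le) auto
  show "hausdorff_dist {a..b} {c..d} \<le> max \<bar>a - c\<bar> \<bar>b - d\<bar>"
    unfolding hausdorff_dist_def
    using le[OF assms] le[OF assms(2,1)] by (simp add: abs_minus_commute)
  have ge: "c - a \<le> (SUP x\<in>{a..b}. infdist x {c..d})"
           "b - d \<le> (SUP x\<in>{a..b}. infdist x {c..d})"
    if "a \<le> b" "c \<le> d" for a b c d :: real
  proof -
    have bdd: "bdd_above ((\<lambda>x. infdist x {c..d}) ` {a..b})"
      using infdist_interval_le[OF _ that(2)] by (intro bdd_aboveI2)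
    show "c - a \<le> (SUP x\<in>{a..b}. infdist x {c..d})"
      by (rule cSUP_upper2[OF bdd, of a]) (use that infdist_interval_ge in auto)
    show "b - d \<le> (SUP x\<in>{a..b}. infdist x {c..d})"
      by (rule cSUP_upper2[OF bdd, of b]) (use that infdist_interval_ge in auto)
  qed
  show "max \<bar>a - c\<bar> \<bar>b - d\<bar> \<le> hausdorff_dist {a..b} {c..d}"
    unfolding hausdorff_dist_def
    using ge[OF assms] ge[OF assms(2,1)] by (auto simp: abs_le_iff)
qed

lemma hausdorff_dist_levels:
  assumes "z \<in> fuzzy_numbers" "r \<in> {0..1}" "r' \<in> {0..1}"
  shows "hausdorff_dist (level z r) (level z r') =
    max \<bar>lower_end z r - lower_end z r'\<bar> \<bar>upper_end z r - upper_end z r'\<bar>"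
  using level_fuzzy_eq[OF assms(1,2)] level_fuzzy_eq[OF assms(1,3)]
  by (metis hausdorff_dist_interval)

text \<open>Levels are compact intervals, so the interval formula for the Hausdorff distance splits
  continuity of the level map into continuity of two real functions.\<close>

lemma fuzzy_hat_iff_continuous_ends:
  "z \<in> fuzzy_hat \<longleftrightarrow> z \<in> fuzzy_numbers \<and>
     continuous_on {0..1} (lower_end z) \<and> continuous_on {0..1} (upper_end z)"
proof (cases "z \<in> fuzzy_numbers")
  case z: True
  have hd: "hausdorff_dist (level z r') (level z r) < e \<longleftrightarrow>
      \<bar>lower_end z r' - lower_end z r\<bar> < e \<and> \<bar>upper_end z r' - upper_end z r\<bar> < e"
    if "r \<in> {0..1}" "r' \<in> {0..1}" for r r' e
    using hausdorff_dist_levels[OF z that(2,1)] by simp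
  have "z \<in> fuzzy_hat \<longleftrightarrow> (\<forall>r\<in>{0..1}. \<forall>e>0. \<exists>d>0. \<forall>r'\<in>{0..1}. \<bar>r' - r\<bar> < d \<longrightarrow>
      hausdorff_dist (level z r') (level z r) < e)"
    using z by (simp add: fuzzy_hat_def)
  also have "\<dots> \<longleftrightarrow> (\<forall>r\<in>{0..1}. \<forall>e>0. \<exists>d>0. \<forall>r'\<in>{0..1}. \<bar>r' - r\<bar> < d \<longrightarrow>
      \<bar>lower_end z r' - lower_end z r\<bar> < e \<and> \<bar>upper_end z r' - upper_end z r\<bar> < e)"
    by (intro ball_cong refl all_cong1 imp_cong ex_cong1 conj_cong hd)
  also have "\<dots> \<longleftrightarrow> continuous_on {0..1} (lower_end z) \<and> continuous_on {0..1} (upper_end z)"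
    (is "?L \<longleftrightarrow> ?R")
  proof
    assume ?L
    then show ?R unfolding continuous_on_iff dist_real_def by meson
  next
    assume R: ?R
    show ?L
    proof (intro ballI allI impI)
      fix r e :: real assume re: "r \<in> {0..1}" "e > 0"
      obtain d1 where d1: "d1 > 0" "\<forall>r'\<in>{0..1}. \<bar>r' - r\<bar> < d1 \<longrightarrow> \<bar>lower_end z r' - lower_end z r\<bar> < e"
        using R re unfolding continuous_on_iff dist_real_def by blast
      obtain d2 where d2: "d2 > 0" "\<forall>r'\<in>{0..1}. \<bar>r' - r\<bar> < d2 \<longrightarrow> \<bar>upper_end z r' - upper_end z r\<bar> < e"
        using R re unfolding continuous_on_iff dist_real_def by blast
      show "\<exists>d>0. \<forall>r'\<in>{0..1}. \<bar>r' - r\<bar> < d \<longrightarrow>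
          \<bar>lower_end z r' - lower_end z r\<bar> < e \<and> \<bar>upper_end z r' - upper_end z r\<bar> < e"
        using d1 d2 by (intro exI[of _ "min d1 d2"]) auto
    qed
  qed
  finally show ?thesis using z by simp
qed (simp add: fuzzy_hat_def)

text \<open>A representation theorem of Goetschel-Voxman type: \<open>z x\<close> is the largest
  level whose interval contains \<open>x\<close>. Sums, metric limits and fractional integrals are
  all obtained from it, by checking the hypotheses for a pair of real functions of the
  level.\<close>

lemma fuzzy_of_ends:
  fixes l u :: "real \<Rightarrow> real"
  assumes contl: "continuous_on {0..1} l" and contu: "continuous_on {0..1} u"
    and l: "mono_on {0..1} l" and u: "antimono_on {0..1} u"
    and lu: "\<And>r. r \<in> {0..1} \<Longrightarrow> l r \<le> u r"
  shows "\<exists>z\<in>fuzzy_hat. \<forall>r\<in>{0..1}. level z r = {l r..u r}"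
proof -
  have mono: "l r \<le> l r'" "u r' \<le> u r" if "0 \<le> r" "r \<le> r'" "r' \<le> 1" for r r'
    using monotone_onD[OF l, of r r'] monotone_onD[OF u, of r r'] that by auto
  \<comment> \<open>The inserted 0 keeps the set nonempty and gives \<open>z\<close> the value 0 at
    points that lie in no level interval. Continuity of \<open>l\<close> and \<open>u\<close> makes
    \<open>S x\<close> closed, so its supremum is attained.\<close>
  define S where "S x = insert 0 {r \<in> {0..1}. l r \<le> x \<and> x \<le> u r}" for x
  define z where "z x = Sup (S x)" for x
  have "closed (insert 0 ({r \<in> {0..1}. l r \<le> x} \<inter> {r \<in> {0..1}. x \<le> u r}))" for x
    using contl contu
    by (intro closed_insert closed_Int continuous_on_closed_Collect_le continuous_on_const) auto
  moreover have "S x = insert 0 ({r \<in> {0..1}. l r \<le> x} \<inter> {r \<in> {0..1}. x \<le> u r})" for x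
    by (auto simp: S_def)
  ultimately have "closed (S x)" for x by simp
  moreover have Sb: "S x \<subseteq> {0..1}" "S x \<noteq> {}" for x by (auto simp: S_def)
  then have bdd: "bdd_above (S x)" for x by (meson bdd_above_Icc bdd_above_mono)
  ultimately have zS: "z x \<in> S x" for x
    unfolding z_def using Sb by (intro closed_contains_Sup) auto
  have z01: "0 \<le> z x" "z x \<le> 1" for x using zS[of x] Sb[of x] by auto
  \<comment> \<open>As the supremum is attained, \<open>x\<close> lies in the interval of level
    \<open>z x\<close>; intervals grow as the level decreases, so it lies in those of all smaller
    positive levels too.\<close>
  have zge: "z x \<ge> r \<longleftrightarrow> l r \<le> x \<and> x \<le> u r" if r: "0 < r" "r \<le> 1" for x r
  proof
    assume "r \<le> z x"
    with r zS[of x] have "l (z x) \<le> x" "x \<le> u (z x)" by (auto simp: S_def)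
    with mono[of r "z x"] r \<open>r \<le> z x\<close> z01[of x] show "l r \<le> x \<and> x \<le> u r" by auto
  next
    assume "l r \<le> x \<and> x \<le> u r"
    then have "r \<in> S x" using r by (auto simp: S_def)
    then show "r \<le> z x" unfolding z_def by (rule cSup_upper[OF _ bdd])
  qed
  \<comment> \<open>Level 0 is a closure and is not covered by \<open>zge\<close>. A point of
    \<open>{l 0..u 0}\<close> is the limit of its clamps to the intervals of levels
    \<open>r n\<close> tending to 0, and these clamps lie in the support.\<close>
  have cl: "closure {x. z x > 0} = {l 0..u 0}"
  proof
    have "{x. z x > 0} \<subseteq> {l 0..u 0}"
    proof
      fix x assume "x \<in> {x. z x > 0}"
      then have "l (z x) \<le> x" "x \<le> u (z x)" using zge[of "z x" x] z01[of x] by auto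
      then show "x \<in> {l 0..u 0}" using mono[of 0 "z x"] z01[of x] by auto
    qed
    then show "closure {x. z x > 0} \<subseteq> {l 0..u 0}" by (rule closure_minimal) simp
    show "{l 0..u 0} \<subseteq> closure {x. z x > 0}"
    proof
      fix x assume x: "x \<in> {l 0..u 0}"
      define r where "r n = inverse (real (Suc n))" for n
      have r: "0 < r n" "r n \<le> 1" for n by (auto simp: r_def field_simps)
      have r0: "r \<longlonglongrightarrow> 0" unfolding r_def by (rule LIMSEQ_inverse_real_of_nat)
      have "(\<lambda>n. l (r n)) \<longlonglongrightarrow> l 0" "(\<lambda>n. u (r n)) \<longlonglongrightarrow> u 0"
        using r by (auto intro!: continuous_on_tendsto_compose[OF contl r0]
            continuous_on_tendsto_compose[OF contu r0] simp: less_imp_le)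
      then have "(\<lambda>n. max (l (r n)) (min x (u (r n)))) \<longlonglongrightarrow> max (l 0) (min x (u 0))"
        by (intro tendsto_intros)
      moreover have "max (l 0) (min x (u 0)) = x" using x by auto
      moreover have "max (l (r n)) (min x (u (r n))) \<in> {x. z x > 0}" for n
      proof -
        have "l (r n) \<le> max (l (r n)) (min x (u (r n))) \<and> max (l (r n)) (min x (u (r n))) \<le> u (r n)"
          using lu[of "r n"] r[of n] by simp
        then have "r n \<le> z (max (l (r n)) (min x (u (r n))))" using zge[OF r] by blast
        then show ?thesis using r(1)[of n] by simp
      qed
      ultimately show "x \<in> closure {x. z x > 0}"
        unfolding closure_sequential
        by (intro exI[of _ "\<lambda>n. max (l (r n)) (min x (u (r n)))"]) simp
    qed
  qed
  have level: "level z r = {l r..u r}" if "r \<in> {0..1}" for r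
    using that cl zge[of r] by (auto simp: level_def)
  have "z \<in> fuzzy_numbers"
    unfolding fuzzy_numbers_def
  proof (intro CollectI conjI allI ballI impI)
    show "0 \<le> z x" "z x \<le> 1" for x by (rule z01)+
    show "\<exists>x0. z x0 = 1"
      using zge[of 1 "l 1"] z01[of "l 1"] lu[of 1] by (intro exI[of _ "l 1"]) auto
    show "compact (closure {x. z x > 0})" by (simp add: cl)
    fix x1 x2 t :: real assume t: "t \<in> {0..1}"
    show "min (z x1) (z x2) \<le> z (t * x1 + (1 - t) * x2)"
    proof (cases "min (z x1) (z x2) = 0")
      case False
      define c where "c = min (z x1) (z x2)"
      have c: "0 < c" "c \<le> 1" using False z01[of x1] z01[of x2] by (auto simp: c_def min_def)
      have "x1 \<in> {l c..u c}" "x2 \<in> {l c..u c}"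
        using zge[OF c, of x1] zge[OF c, of x2] by (auto simp: c_def)
      then have "t *\<^sub>R x1 + (1 - t) *\<^sub>R x2 \<in> {l c..u c}"
        using t by (intro convexD[OF convex_real_interval(5)]) auto
      then show ?thesis using zge[OF c] by (simp add: c_def)
    qed (use z01 in simp)
  next
    fix x c assume xc: "z x < c"
    show "\<forall>\<^sub>F y in at x. z y < c"
    \<comment> \<open>For \<open>c\<close> in (0,1] the set where \<open>z y < c\<close> is the
      complement of a closed interval, hence open; for \<open>c > 1\<close> it is the whole
      line.\<close>
    proof (cases "c \<le> 1")
      case True
      then have c: "0 < c" "c \<le> 1" using xc z01[of x] by auto
      have eq: "z y < c \<longleftrightarrow> y \<in> - {l c..u c}" for y using zge[OF c, of y] by auto
      show ?thesis
        unfolding eq by (rule eventually_at_in_open') (use xc eq in auto)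
    next
      case False
      then have "z y < c" for y using z01(2)[of y] by linarith
      then show ?thesis by simp
    qed
  qed
  moreover have ends: "lower_end z r = l r" "upper_end z r = u r" if "r \<in> {0..1}" for r
    by (rule ends_of_level[OF level[OF that] lu[OF that]])+
  have "continuous_on {0..1} (lower_end z)" "continuous_on {0..1} (upper_end z)"
    by (rule continuous_on_eq[OF contl ends(1)[symmetric]], assumption,
        rule continuous_on_eq[OF contu ends(2)[symmetric]], assumption)
  ultimately have "z \<in> fuzzy_hat"
    by (simp add: fuzzy_hat_iff_continuous_ends)
  then show ?thesis by (intro bexI[of _ z] ballI level)
qed

section \<open>Levelwise addition and the Hukuhara difference\<close>

lemma sumset_interval:
  fixes a b c d :: real
  assumes "a \<le> b" "c \<le> d"
  shows "{x + y | x y. x \<in> {a..b} \<and> y \<in> {c..d}} = {a + c..b + d}"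
proof (intro set_eqI iffI)
  fix w assume w: "w \<in> {a + c..b + d}"
  \<comment> \<open>The least first summand that is at least \<open>a\<close> and leaves a remainder
    of at most \<open>d\<close>.\<close>
  define x where "x = max a (w - d)"
  have "x \<in> {a..b}" "w - x \<in> {c..d}" using w assms by (auto simp: x_def max_def)
  then show "w \<in> {x + y | x y. x \<in> {a..b} \<and> y \<in> {c..d}}"
    by (intro CollectI exI[of _ x] exI[of _ "w - x"]) simp
qed auto

text \<open>Sums of the endpoint functions inherit continuity, monotonicity and order, so
  \<open>fuzzy_of_ends\<close> supplies a candidate; levels determine a fuzzy number, so the
  definite description denotes it.\<close>

lemma fuzzy_add:
  assumes p: "p \<in> fuzzy_hat" and q: "q \<in> fuzzy_hat"
  shows "fuzzy_add p q \<in> fuzzy_hat"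
    and "r \<in> {0..1} \<Longrightarrow> lower_end (fuzzy_add p q) r = lower_end p r + lower_end q r"
    and "r \<in> {0..1} \<Longrightarrow> upper_end (fuzzy_add p q) r = upper_end p r + upper_end q r"
proof -
  note pn = fuzzy_hat_D[OF p] and qn = fuzzy_hat_D[OF q]
  let ?l = "\<lambda>r. lower_end p r + lower_end q r" and ?u = "\<lambda>r. upper_end p r + upper_end q r"
  have lu: "?l r \<le> ?u r" if "r \<in> {0..1}" for r
    using level_fuzzy_eq(2)[OF pn that] level_fuzzy_eq(2)[OF qn that] by simp
  have "continuous_on {0..1} ?l" "continuous_on {0..1} ?u"
    using p q by (auto simp: fuzzy_hat_iff_continuous_ends intro: continuous_on_add)
  moreover have "mono_on {0..1} ?l" "antimono_on {0..1} ?u"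
    by (auto intro!: monotone_onI add_mono ends_mono pn qn)
  ultimately have "\<exists>z\<in>fuzzy_hat. \<forall>r\<in>{0..1}. level z r = {?l r..?u r}"
    using lu by (rule fuzzy_of_ends)
  then obtain z where z: "z \<in> fuzzy_hat"
    and "\<forall>r\<in>{0..1}. level z r = {?l r..?u r}"
    by (rule bexE)
  note level = bspec[OF this(2)]
  have sumset: "{x + y | x y. x \<in> level p r \<and> y \<in> level q r} = {?l r..?u r}"
    if "r \<in> {0..1}" for r
    unfolding level_fuzzy_eq(1)[OF pn that] level_fuzzy_eq(1)[OF qn that]
    by (intro sumset_interval level_fuzzy_eq(2) pn qn that)
  have "fuzzy_add p q = z"
    unfolding fuzzy_add_def
  proof (rule the_equality)
    show "z \<in> fuzzy_numbers \<and>
      (\<forall>r\<in>{0..1}. level z r = {x + y | x y. x \<in> level p r \<and> y \<in> level q r})"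
      using fuzzy_hat_D[OF z] level sumset by simp
    fix w assume w: "w \<in> fuzzy_numbers \<and>
      (\<forall>r\<in>{0..1}. level w r = {x + y | x y. x \<in> level p r \<and> y \<in> level q r})"
    show "w = z"
      by (rule fuzzy_eqI) (use w fuzzy_hat_D[OF z] level sumset in simp_all)
  qed
  then show "fuzzy_add p q \<in> fuzzy_hat"
    and "r \<in> {0..1} \<Longrightarrow> lower_end (fuzzy_add p q) r = ?l r"
    and "r \<in> {0..1} \<Longrightarrow> upper_end (fuzzy_add p q) r = ?u r"
    using z ends_of_level[OF level lu] by auto
qed

text \<open>Fuzzy addition is real addition on endpoints and therefore cancellative: a Hukuhara
  difference is unique as soon as it exists.\<close>

lemma hdiff_in_fuzzy_hat:
  assumes "hdiff_exists p q" and q: "q \<in> fuzzy_hat"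
  shows "hdiff p q \<in> fuzzy_hat"
proof -
  obtain w where w: "w \<in> fuzzy_hat" "p = fuzzy_add q w"
    using assms(1) by (auto simp: hdiff_exists_def)
  have "w' = w" if w': "w' \<in> fuzzy_hat" "p = fuzzy_add q w'" for w'
  proof (rule fuzzy_eqI_ends)
    fix r :: real assume r: "r \<in> {0..1}"
    show "lower_end w' r = lower_end w r" "upper_end w' r = upper_end w r"
      using fuzzy_add(2,3)[OF q w(1) r] fuzzy_add(2,3)[OF q w'(1) r] w(2) w'(2) by auto
  qed (use w w' fuzzy_hat_D in auto)
  then have "hdiff p q = w"
    unfolding hdiff_def using w by (intro the_equality) auto
  with w show ?thesis by simp
qed

lemma abs_ends_diff_le:
  assumes "p \<in> fuzzy_numbers" "q \<in> fuzzy_numbers" "r \<in> {0..1}"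
  shows "\<bar>lower_end p r - lower_end q r\<bar> \<le> fuzzy_dist p q"
    and "\<bar>upper_end p r - upper_end q r\<bar> \<le> fuzzy_dist p q"
  using fuzzy_dist_le_iff[OF assms(1,2), of "fuzzy_dist p q"] assms(3) by auto

text \<open>The metric is the uniform distance of endpoint functions. A Cauchy sequence has uniform
  limits of its endpoint functions; these are again continuous, monotone and ordered, and
  \<open>fuzzy_of_ends\<close> turns them into the limit.\<close>

lemma mcomplete_fuzzy_hat: "Metric_space.mcomplete fuzzy_hat fuzzy_dist"
proof -
  interpret E: Metric_space fuzzy_hat fuzzy_dist by (rule Metric_space_fuzzy_hat)
  show ?thesis
    unfolding E.mcomplete_def
  proof (intro allI impI)
    fix \<sigma> assume "E.MCauchy \<sigma>"
    then have \<sigma>: "\<And>n. \<sigma> n \<in> fuzzy_hat"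
      and cauchy: "\<And>e. e > 0 \<Longrightarrow> \<exists>N. \<forall>n\<ge>N. \<forall>m\<ge>N. fuzzy_dist (\<sigma> n) (\<sigma> m) < e"
      by (auto simp: E.MCauchy_def)
    note \<sigma>n = fuzzy_hat_D[OF \<sigma>]
    have "uniformly_convergent_on {0..1} (\<lambda>n. f (\<sigma> n))"
      if f: "\<And>m n r. r \<in> {0..1} \<Longrightarrow> \<bar>f (\<sigma> n) r - f (\<sigma> m) r\<bar> \<le> fuzzy_dist (\<sigma> n) (\<sigma> m)"
      for f :: "(real \<Rightarrow> real) \<Rightarrow> real \<Rightarrow> real"
      unfolding uniformly_convergent_eq_Cauchy uniformly_Cauchy_on_def dist_real_def
    proof (intro allI impI)
      fix e :: real assume "e > 0"
      then obtain N where "\<forall>n\<ge>N. \<forall>m\<ge>N. fuzzy_dist (\<sigma> n) (\<sigma> m) < e" using cauchy by blast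
      then show "\<exists>N. \<forall>r\<in>{0..1}. \<forall>m\<ge>N. \<forall>n\<ge>N. \<bar>f (\<sigma> m) r - f (\<sigma> n) r\<bar> < e"
        using f by (intro exI[of _ N] ballI allI impI) (blast intro: le_less_trans)
    qed
    from this[of lower_end] this[of upper_end]
    have "uniformly_convergent_on {0..1} (\<lambda>n. lower_end (\<sigma> n))"
         "uniformly_convergent_on {0..1} (\<lambda>n. upper_end (\<sigma> n))"
      using abs_ends_diff_le[OF \<sigma>n \<sigma>n] by auto
    then obtain l u where l: "uniform_limit {0..1} (\<lambda>n. lower_end (\<sigma> n)) l sequentially"
      and u: "uniform_limit {0..1} (\<lambda>n. upper_end (\<sigma> n)) u sequentially"
      by (auto simp: uniformly_convergent_on_def)
    have lim: "(\<lambda>n. lower_end (\<sigma> n) r) \<longlonglongrightarrow> l r" "(\<lambda>n. upper_end (\<sigma> n) r) \<longlonglongrightarrow> u r"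
      if "r \<in> {0..1}" for r
      using l u that by (auto intro: tendsto_uniform_limitI)
    have cont: "continuous_on {0..1} l" "continuous_on {0..1} u"
      using \<sigma> by (auto intro!: uniform_limit_theorem[OF _ l] uniform_limit_theorem[OF _ u]
          always_eventually simp: fuzzy_hat_iff_continuous_ends)
    have mono: "mono_on {0..1} l" "antimono_on {0..1} u"
      by (auto intro!: monotone_onI LIMSEQ_le[OF lim(1) lim(1)] LIMSEQ_le[OF lim(2) lim(2)]
          ends_mono \<sigma>n)
    have lu: "l r \<le> u r" if "r \<in> {0..1}" for r
      using level_fuzzy_eq(2)[OF \<sigma>n that] by (intro LIMSEQ_le[OF lim[OF that]]) auto
    obtain z where z: "z \<in> fuzzy_hat" and "\<forall>r\<in>{0..1}. level z r = {l r..u r}"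
      using fuzzy_of_ends[OF cont mono lu] by (rule bexE)
    note level = bspec[OF this(2)]
    note ends = ends_of_level[OF level lu]
    have "limitin E.mtopology \<sigma> z sequentially"
      unfolding E.limit_metric_sequentially
    proof (intro conjI allI impI)
      fix e :: real assume "e > 0"
      then have "\<forall>\<^sub>F n in sequentially. (\<forall>r\<in>{0..1}. dist (lower_end (\<sigma> n) r) (l r) < e/2) \<and>
          (\<forall>r\<in>{0..1}. dist (upper_end (\<sigma> n) r) (u r) < e/2)"
        by (intro eventually_conj uniform_limitD[OF l] uniform_limitD[OF u] half_gt_zero)
      then obtain N where N: "\<And>n r. n \<ge> N \<Longrightarrow> r \<in> {0..1} \<Longrightarrow>
          \<bar>lower_end (\<sigma> n) r - l r\<bar> < e/2 \<and> \<bar>upper_end (\<sigma> n) r - u r\<bar> < e/2"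
        unfolding eventually_sequentially dist_real_def by blast
      \<comment> \<open>Strict bounds at every level give only a non-strict bound for the supremum,
        hence the margin \<open>e/2\<close>.\<close>
      have "fuzzy_dist (\<sigma> n) z \<le> e/2" if "n \<ge> N" for n
        unfolding fuzzy_dist_le_iff[OF \<sigma>n fuzzy_hat_D[OF z]]
        using N[OF that] ends by (auto intro: less_imp_le)
      then have "fuzzy_dist (\<sigma> n) z < e" if "n \<ge> N" for n
        using that \<open>e > 0\<close> by fastforce
      then show "\<exists>N. \<forall>n\<ge>N. \<sigma> n \<in> fuzzy_hat \<and> fuzzy_dist (\<sigma> n) z < e"
        using \<sigma> by blast
    qed (rule z)
    then show "\<exists>x. limitin E.mtopology \<sigma> x sequentially" by blast
  qed
qed

section \<open>The Katugampola kernel\<close>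

text \<open>One factor of the kernel, extended by zero outside \<open>{0..x}\<close>. Integrals over
  rectangles that vary with the upper corner thereby become integrals over one fixed space, and the
  kernels of different corners can be subtracted.\<close>

definition kat_kernel1 :: "real \<Rightarrow> real \<Rightarrow> real \<Rightarrow> real \<Rightarrow> real" where
  "kat_kernel1 \<rho> \<phi> x s =
     indicator {0..x} s * (s powr (\<rho> - 1) / (x powr \<rho> - s powr \<rho>) powr (1 - \<phi>))"

lemma kat_kernel1_nonneg: "0 \<le> kat_kernel1 \<rho> \<phi> x s"
  by (simp add: kat_kernel1_def)

lemma measurable_kat_kernel1 [measurable]: "kat_kernel1 \<rho> \<phi> x \<in> borel_measurable borel"
  unfolding kat_kernel1_def by measurable

text \<open>Up to the factor \<open>1 / \<rho>\<close>, the substitution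
  \<open>u = x powr \<rho> - s powr \<rho>\<close> turns the kernel into
  \<open>u powr (\<phi> - 1)\<close>, which explains the antiderivative \<open>?f\<close>.\<close>

lemma nn_integral_kat_kernel1:
  assumes "\<rho> > 0" "\<phi> > 0" "x \<ge> 0"
  shows "(\<integral>\<^sup>+s. kat_kernel1 \<rho> \<phi> x s \<partial>lborel) = ennreal (x powr (\<rho> * \<phi>) / (\<rho> * \<phi>))"
proof -
  let ?k = "\<lambda>s. s powr (\<rho> - 1) / (x powr \<rho> - s powr \<rho>) powr (1 - \<phi>)"
  let ?f = "\<lambda>s. - ((x powr \<rho> - s powr \<rho>) powr \<phi>) / (\<rho> * \<phi>)"
  have "(?k has_integral (?f x - ?f 0)) {0..x}"
  \<comment> \<open>The integrand may be singular at both ends while \<open>?f\<close> is continuous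
    on the closed interval, so the derivative is taken in the interior only.\<close>
  proof (rule fundamental_theorem_of_calculus_interior)
    have "continuous_on {0..x} (\<lambda>s. x powr \<rho> - s powr \<rho>)"
      using assms by (intro continuous_intros continuous_on_powr') auto
    then show "continuous_on {0..x} ?f"
      using assms by (intro continuous_intros continuous_on_powr') (auto intro: powr_mono2)
    show "(?f has_vector_derivative ?k s) (at s)" if s: "s \<in> {0<..<x}" for s
    proof -
      have "s powr \<rho> < x powr \<rho>" using s assms by (intro powr_less_mono2) auto
      then show ?thesis
        unfolding has_real_derivative_iff_has_vector_derivative[symmetric]
        using s assms
        by (auto intro!: derivative_eq_intros
            simp: powr_diff powr_minus field_simps)
    qed
  qed (use assms in simp)
  also have "?f x - ?f 0 = x powr (\<rho> * \<phi>) / (\<rho> * \<phi>)"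
    using assms by (simp add: powr_powr)
  finally have "(?k has_integral (x powr (\<rho> * \<phi>) / (\<rho> * \<phi>))) {0..x}" .
  then have "(\<integral>\<^sup>+s. indicator {0..x} s * ?k s \<partial>lborel) = ennreal (x powr (\<rho> * \<phi>) / (\<rho> * \<phi>))"
    by (intro nn_integral_has_integral_lebesgue) auto
  then show ?thesis
    by (simp add: kat_kernel1_def)
qed

text \<open>At the excluded point \<open>s = x\<close> the indicator jumps and the power may be
  singular. Elsewhere the indicator is eventually constant along \<open>X\<close>.\<close>

lemma kat_kernel1_tendsto:
  assumes \<rho>: "\<rho> > 0" and X: "X \<longlonglongrightarrow> x" and s: "s \<noteq> x"
  shows "(\<lambda>n. kat_kernel1 \<rho> \<phi> (X n) s) \<longlonglongrightarrow> kat_kernel1 \<rho> \<phi> x s"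
proof -
  consider "s < 0" | "s > x" | "0 \<le> s" "s < x" using s by linarith
  then show ?thesis
  proof cases
    case 1
    then show ?thesis by (simp add: kat_kernel1_def)
  next
    case 2
    then have "\<forall>\<^sub>F n in sequentially. X n < s" using order_tendstoD(2)[OF X] by blast
    then have "\<forall>\<^sub>F n in sequentially. kat_kernel1 \<rho> \<phi> x s = kat_kernel1 \<rho> \<phi> (X n) s"
      by eventually_elim (use 2 in \<open>simp add: kat_kernel1_def\<close>)
    then show ?thesis by (rule Lim_transform_eventually[OF tendsto_const])
  next
    case 3
    let ?k = "\<lambda>x. s powr (\<rho> - 1) / (x powr \<rho> - s powr \<rho>) powr (1 - \<phi>)"
    have "s powr \<rho> < x powr \<rho>" using 3 \<rho> by (intro powr_less_mono2) auto
    then have "(\<lambda>n. ?k (X n)) \<longlonglongrightarrow> ?k x"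
      using 3 by (intro tendsto_intros X) auto
    moreover have "\<forall>\<^sub>F n in sequentially. s < X n" using 3 order_tendstoD(1)[OF X] by blast
    then have "\<forall>\<^sub>F n in sequentially. ?k (X n) = kat_kernel1 \<rho> \<phi> (X n) s"
      by eventually_elim (use 3 in \<open>simp add: kat_kernel1_def\<close>)
    ultimately have "(\<lambda>n. kat_kernel1 \<rho> \<phi> (X n) s) \<longlonglongrightarrow> ?k x"
      by (rule Lim_transform_eventually)
    then show ?thesis using 3 by (simp add: kat_kernel1_def)
  qed
qed

locale katugampola =
  fixes \<rho>1 \<rho>2 \<phi>1 \<phi>2 :: real
  assumes \<rho>1: "\<rho>1 > 0" and \<rho>2: "\<rho>2 > 0" and \<phi>1: "\<phi>1 > 0" and \<phi>2: "\<phi>2 > 0"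
begin

definition kern :: "real \<times> real \<Rightarrow> real \<times> real \<Rightarrow> real" where
  "kern p q = kat_kernel1 \<rho>1 \<phi>1 (fst p) (fst q) * kat_kernel1 \<rho>2 \<phi>2 (snd p) (snd q)"

definition coeff :: real where
  "coeff = \<rho>1 powr (1 - \<phi>1) * \<rho>2 powr (1 - \<phi>2) / (Gamma \<phi>1 * Gamma \<phi>2)"

text \<open>The total integral of \<open>kern p\<close> over the plane, see
  \<open>nn_integral_kern\<close>.\<close>

definition mass :: "real \<times> real \<Rightarrow> real" where
  "mass p = fst p powr (\<rho>1 * \<phi>1) / (\<rho>1 * \<phi>1) * (snd p powr (\<rho>2 * \<phi>2) / (\<rho>2 * \<phi>2))"

lemma kern_nonneg: "0 \<le> kern p q"
  by (simp add: kern_def kat_kernel1_nonneg)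

lemma mass_nonneg: "0 \<le> mass p"
  using \<rho>1 \<rho>2 \<phi>1 \<phi>2 by (simp add: mass_def)

lemma coeff_nonneg: "0 \<le> coeff"
  using \<phi>1 \<phi>2 Gamma_real_pos by (simp add: coeff_def less_imp_le)

lemma measurable_kern: "kern p \<in> borel_measurable borel"
proof -
  have "kern p \<in> borel_measurable (borel \<Otimes>\<^sub>M borel)"
    unfolding kern_def by measurable
  then show ?thesis by (simp add: borel_prod)
qed

lemma kern_eq_0: "q \<notin> {0..fst p} \<times> {0..snd p} \<Longrightarrow> kern p q = 0"
  by (cases q) (auto simp: kern_def kat_kernel1_def)

lemma kern_eq:
  "kern (x, y) (s, t) = indicator ({0..x} \<times> {0..y}) (s, t) * kat_kernel \<rho>1 \<rho>2 \<phi>1 \<phi>2 x y s t"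
  by (simp add: kern_def kat_kernel1_def kat_kernel_def indicator_times)

text \<open>By Tonelli the product kernel integrates to the product of the two one-variable
  masses.\<close>

lemma nn_integral_kern:
  assumes "0 \<le> fst p" "0 \<le> snd p"
  shows "(\<integral>\<^sup>+q. kern p q \<partial>lborel) = ennreal (mass p)"
proof -
  let ?k1 = "kat_kernel1 \<rho>1 \<phi>1 (fst p)" and ?k2 = "kat_kernel1 \<rho>2 \<phi>2 (snd p)"
  have "(\<integral>\<^sup>+q. kern p q \<partial>lborel) = (\<integral>\<^sup>+q. kern p q \<partial>(lborel \<Otimes>\<^sub>M lborel))"
    by (simp add: lborel_prod)
  also have "\<dots> = (\<integral>\<^sup>+s. \<integral>\<^sup>+t. kern p (s, t) \<partial>lborel \<partial>lborel)"
    by (subst lborel.nn_integral_fst) (use measurable_kern[of p] in \<open>simp_all add: lborel_prod\<close>)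
  also have "\<dots> = (\<integral>\<^sup>+s. \<integral>\<^sup>+t. ennreal (?k1 s) * ennreal (?k2 t) \<partial>lborel \<partial>lborel)"
    by (simp add: kern_def ennreal_mult kat_kernel1_nonneg)
  also have "\<dots> = (\<integral>\<^sup>+s. ennreal (?k1 s) \<partial>lborel) * (\<integral>\<^sup>+t. ennreal (?k2 t) \<partial>lborel)"
    by (simp add: nn_integral_cmult nn_integral_multc)
  also have "\<dots> = ennreal (mass p)"
    unfolding mass_def using assms \<rho>1 \<rho>2 \<phi>1 \<phi>2
    by (subst ennreal_mult) (simp_all add: nn_integral_kat_kernel1)
  finally show ?thesis .
qed

lemma has_bochner_integral_kern:
  assumes "0 \<le> fst p" "0 \<le> snd p"
  shows "has_bochner_integral lebesgue (kern p) (mass p)"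
  by (rule has_bochner_integral_nn_integral)
    (use nn_integral_kern[OF assms] measurable_kern[of p] in
      \<open>auto simp: kern_nonneg mass_nonneg nn_integral_completion intro: measurable_completion\<close>)

text \<open>The singularity moves with \<open>X n\<close>; convergence of the explicit masses takes
  the place of a dominating function.\<close>

lemma kern_tendsto_L1:
  assumes X: "\<And>n. X n \<in> {0..} \<times> {0..}" and p: "p \<in> {0..} \<times> {0..}" and lim: "X \<longlonglongrightarrow> p"
  shows "(\<lambda>n. \<integral>q. \<bar>kern (X n) q - kern p q\<bar> \<partial>lebesgue) \<longlonglongrightarrow> 0"
proof -
  have X0: "0 \<le> fst (X n)" "0 \<le> snd (X n)" for n using X[of n] by auto
  have p0: "0 \<le> fst p" "0 \<le> snd p" using p by auto
  note int = has_bochner_integral_kern[THEN has_bochner_integral_iff[THEN iffD1], THEN conjunct1]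
  have lim12: "(\<lambda>n. fst (X n)) \<longlonglongrightarrow> fst p" "(\<lambda>n. snd (X n)) \<longlonglongrightarrow> snd p"
    using lim by (auto intro: tendsto_fst tendsto_snd)
  have "(\<lambda>n. mass (X n)) \<longlonglongrightarrow> mass p"
    unfolding mass_def using \<rho>1 \<rho>2 \<phi>1 \<phi>2 X0
    by (intro tendsto_intros tendsto_powr' lim12) auto
  then have "(\<lambda>n. ennreal (mass (X n))) \<longlonglongrightarrow> ennreal (mass p)"
    by (rule tendsto_ennrealI)
  then have limsup: "limsup (\<lambda>n. ennreal (mass (X n))) = ennreal (mass p)"
    by (rule lim_imp_Limsup[OF sequentially_bot])
  have norm: "(\<integral>\<^sup>+q. norm (kern r q) \<partial>lebesgue) = ennreal (mass r)" if "0 \<le> fst r" "0 \<le> snd r" for r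
    using nn_integral_kern[OF that] by (simp add: kern_nonneg nn_integral_completion)
  have null: "{q. q \<bullet> i = c} \<in> null_sets lebesgue" if "i \<in> Basis" for i :: "real \<times> real" and c
    using negligible_standard_hyperplane[OF that] by (simp add: negligible_iff_null_sets)
  \<comment> \<open>Pointwise convergence may fail on the two lines through \<open>p\<close>
    parallel to the axes; both are null sets.\<close>
  have "AE q in lebesgue. q \<notin> {q :: real \<times> real. q \<bullet> (1, 0) = fst p}"
       "AE q in lebesgue. q \<notin> {q :: real \<times> real. q \<bullet> (0, 1) = snd p}"
    by (rule AE_not_in, rule null, simp add: Basis_prod_def)+
  then have "AE q in lebesgue. (\<lambda>n. kern (X n) q) \<longlonglongrightarrow> kern p q"
  proof eventually_elim
    case (elim q)
    then show ?case
      unfolding kern_def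
      by (intro tendsto_mult kat_kernel1_tendsto lim12 \<rho>1 \<rho>2) (auto simp: inner_prod_def)
  qed
  then have "(\<lambda>n. \<integral>\<^sup>+q. norm (kern (X n) q - kern p q) \<partial>lebesgue) \<longlonglongrightarrow> 0"
    by (intro Scheffe_lemma1 int X0 p0) (simp_all only: norm X0 p0 limsup order_refl)
  also have "(\<lambda>n. \<integral>\<^sup>+q. norm (kern (X n) q - kern p q) \<partial>lebesgue) =
      (\<lambda>n. ennreal (\<integral>q. \<bar>kern (X n) q - kern p q\<bar> \<partial>lebesgue))"
    unfolding real_norm_def
    by (intro ext nn_integral_eq_integral integrable_abs Bochner_Integration.integrable_diff
        int X0 p0) auto
  finally show ?thesis
    by (intro tendsto_ennrealD[where x = 0]) auto
qed

section \<open>Real fractional integrals as integrals over the plane\<close>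

lemma kat_integral_real_eq:
  "kat_integral_real \<rho>1 \<rho>2 \<phi>1 \<phi>2 f (fst p) (snd p) = coeff * (\<integral>q. kern p q * f q \<partial>lebesgue)"
proof -
  have "indicator ({0..fst p} \<times> {0..snd p}) q *\<^sub>R
      (case q of (s, t) \<Rightarrow> kat_kernel \<rho>1 \<rho>2 \<phi>1 \<phi>2 (fst p) (snd p) s t * f (s, t)) = kern p q * f q" for q
    using kern_eq[of "fst p" "snd p"] by (cases q) simp
  then show ?thesis
    by (simp add: kat_integral_real_def coeff_def set_lebesgue_integral_def)
qed

lemma set_integrable_kern:
  "set_integrable lebesgue ({0..fst p} \<times> {0..snd p})
      (\<lambda>(s, t). kat_kernel \<rho>1 \<rho>2 \<phi>1 \<phi>2 (fst p) (snd p) s t * f (s, t)) \<longleftrightarrow>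
    integrable lebesgue (\<lambda>q. kern p q * f q)"
proof -
  have "indicator ({0..fst p} \<times> {0..snd p}) q *\<^sub>R
      (case q of (s, t) \<Rightarrow> kat_kernel \<rho>1 \<rho>2 \<phi>1 \<phi>2 (fst p) (snd p) s t * f (s, t)) = kern p q * f q" for q
    using kern_eq[of "fst p" "snd p"] by (cases q) simp
  then show ?thesis
    by (simp add: set_integrable_def)
qed

abbreviation kat_real :: "(real \<times> real \<Rightarrow> real) \<Rightarrow> real \<times> real \<Rightarrow> real" where
  "kat_real f p \<equiv> coeff * (\<integral>q. kern p q * f q \<partial>lebesgue)"

lemma kat_real_mono:
  assumes "integrable lebesgue (\<lambda>q. kern p q * f q)" "integrable lebesgue (\<lambda>q. kern p q * g q)"
    and le: "\<And>q. q \<in> {0..fst p} \<times> {0..snd p} \<Longrightarrow> f q \<le> g q"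
  shows "kat_real f p \<le> kat_real g p"
proof (rule mult_left_mono[OF integral_mono[OF assms(1,2)] coeff_nonneg])
  show "kern p q * f q \<le> kern p q * g q" for q
    using le[of q] kern_nonneg[of p q] kern_eq_0[of q p]
    by (cases "q \<in> {0..fst p} \<times> {0..snd p}") (auto intro: mult_left_mono)
qed

text \<open>A difference of size at most \<open>M\<close> is averaged against a nonnegative kernel
  of total mass \<open>mass p\<close>. This is the source of the contraction factor.\<close>

lemma kat_real_diff_le:
  assumes p: "0 \<le> fst p" "0 \<le> snd p"
    and f: "integrable lebesgue (\<lambda>q. kern p q * f q)" and g: "integrable lebesgue (\<lambda>q. kern p q * g q)"
    and le: "\<And>q. q \<in> {0..fst p} \<times> {0..snd p} \<Longrightarrow> \<bar>f q - g q\<bar> \<le> M"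
  shows "\<bar>kat_real f p - kat_real g p\<bar> \<le> coeff * mass p * M"
proof -
  note int = has_bochner_integral_kern[OF p, THEN has_bochner_integral_iff[THEN iffD1]]
  have "\<bar>kat_real f p - kat_real g p\<bar> = coeff * \<bar>\<integral>q. kern p q * (f q - g q) \<partial>lebesgue\<bar>"
    using f g coeff_nonneg
    by (simp add: right_diff_distrib[symmetric] abs_mult Bochner_Integration.integral_diff[symmetric])
  also have "\<dots> \<le> coeff * (\<integral>q. kern p q * M \<partial>lebesgue)"
  proof (rule mult_left_mono[OF integral_abs_bound_integral coeff_nonneg])
    show "integrable lebesgue (\<lambda>q. kern p q * (f q - g q))"
      using Bochner_Integration.integrable_diff[OF f g] by (simp add: right_diff_distrib)
    show "integrable lebesgue (\<lambda>q. kern p q * M)" using int by simp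
    show "\<bar>kern p q * (f q - g q)\<bar> \<le> kern p q * M" for q
      using le[of q] kern_nonneg[of p q] kern_eq_0[of q p]
      by (cases "q \<in> {0..fst p} \<times> {0..snd p}") (auto simp: abs_mult intro: mult_left_mono)
  qed
  also have "\<dots> = coeff * mass p * M" using int by simp
  finally show ?thesis .
qed

text \<open>\<open>f\<close> and \<open>g\<close> may each be unbounded; only \<open>f - g\<close>
  is controlled. Hence the second difference, which collapses to one integral of
  \<open>(kern p q - kern p' q) * (f q - g q)\<close>.\<close>

lemma kat_real_diff_modulus:
  assumes p: "0 \<le> fst p" "0 \<le> snd p" and p': "0 \<le> fst p'" "0 \<le> snd p'"
    and f: "integrable lebesgue (\<lambda>q. kern p q * f q)" "integrable lebesgue (\<lambda>q. kern p' q * f q)"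
    and g: "integrable lebesgue (\<lambda>q. kern p q * g q)" "integrable lebesgue (\<lambda>q. kern p' q * g q)"
    and le: "\<And>q. q \<in> {0..fst p} \<times> {0..snd p} \<union> {0..fst p'} \<times> {0..snd p'} \<Longrightarrow> \<bar>f q - g q\<bar> \<le> M"
  shows "\<bar>(kat_real f p - kat_real g p) - (kat_real f p' - kat_real g p')\<bar> \<le>
    coeff * M * (\<integral>q. \<bar>kern p q - kern p' q\<bar> \<partial>lebesgue)"
proof -
  note int = has_bochner_integral_kern[THEN has_bochner_integral_iff[THEN iffD1], THEN conjunct1]
  have eq: "(kern p q * f q - kern p q * g q) - (kern p' q * f q - kern p' q * g q) =
      (kern p q - kern p' q) * (f q - g q)" for q
    by (simp add: algebra_simps)
  have "(kat_real f p - kat_real g p) - (kat_real f p' - kat_real g p') =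
      coeff * (\<integral>q. (kern p q - kern p' q) * (f q - g q) \<partial>lebesgue)"
  proof -
    have "(\<integral>q. (kern p q - kern p' q) * (f q - g q) \<partial>lebesgue) =
        ((\<integral>q. kern p q * f q \<partial>lebesgue) - (\<integral>q. kern p q * g q \<partial>lebesgue)) -
        ((\<integral>q. kern p' q * f q \<partial>lebesgue) - (\<integral>q. kern p' q * g q \<partial>lebesgue))"
      using f g by (simp flip: eq)
    then show ?thesis by (simp only: right_diff_distrib)
  qed
  then have "\<bar>(kat_real f p - kat_real g p) - (kat_real f p' - kat_real g p')\<bar> =
      coeff * \<bar>\<integral>q. (kern p q - kern p' q) * (f q - g q) \<partial>lebesgue\<bar>"
    using coeff_nonneg by (simp add: abs_mult)
  also have "\<dots> \<le> coeff * (\<integral>q. \<bar>kern p q - kern p' q\<bar> * M \<partial>lebesgue)"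
  proof (rule mult_left_mono[OF integral_abs_bound_integral coeff_nonneg])
    show "integrable lebesgue (\<lambda>q. (kern p q - kern p' q) * (f q - g q))"
      using f g by (simp flip: eq)
    show "integrable lebesgue (\<lambda>q. \<bar>kern p q - kern p' q\<bar> * M)"
      using int[OF p] int[OF p'] by simp
    show "\<bar>(kern p q - kern p' q) * (f q - g q)\<bar> \<le> \<bar>kern p q - kern p' q\<bar> * M" for q
    \<comment> \<open>Outside both rectangles both kernels vanish, so the bound \<open>M\<close> is
      only called upon inside their union.\<close>
    proof (cases "q \<in> {0..fst p} \<times> {0..snd p} \<union> {0..fst p'} \<times> {0..snd p'}")
      case True
      then show ?thesis using le[OF True] by (simp add: abs_mult mult_left_mono)
    next
      case False
      then show ?thesis using kern_eq_0[of q p] kern_eq_0[of q p'] by simp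
    qed
  qed
  also have "\<dots> = coeff * M * (\<integral>q. \<bar>kern p q - kern p' q\<bar> \<partial>lebesgue)" by simp
  finally show ?thesis .
qed

text \<open>In each variable \<open>Gamma (\<phi> + 1) = \<phi> * Gamma \<phi>\<close> absorbs the
  factor \<open>1 / \<phi>\<close>, and \<open>\<rho> powr (1 - \<phi>) / \<rho>\<close> moves into
  the power as \<open>\<rho> powr (- \<phi>)\<close>. Multiplied by \<open>R\<close> this is the
  constant \<Xi>.\<close>

lemma coeff_mass:
  assumes "0 \<le> a" "0 \<le> b"
  shows "coeff * mass (a, b) =
    (a powr \<rho>1 / \<rho>1) powr \<phi>1 * (b powr \<rho>2 / \<rho>2) powr \<phi>2 / (Gamma (\<phi>1 + 1) * Gamma (\<phi>2 + 1))"
proof -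
  have "x powr (\<rho> * \<phi>) / (\<rho> * \<phi>) * (\<rho> powr (1 - \<phi>) / Gamma \<phi>) = (x powr \<rho> / \<rho>) powr \<phi> / Gamma (\<phi> + 1)"
    if "0 \<le> x" "\<rho> > 0" "\<phi> > 0" for x \<rho> \<phi> :: real
  proof -
    have "Gamma (\<phi> + 1) = \<phi> * Gamma \<phi>"
      using that by (intro Gamma_plus1) (auto elim!: nonpos_Ints_cases)
    then show ?thesis
      using that Gamma_real_pos[of \<phi>]
      by (simp add: powr_divide powr_powr powr_diff field_simps)
  qed
  note eq = this[OF assms(1) \<rho>1 \<phi>1] this[OF assms(2) \<rho>2 \<phi>2]
  have "coeff * mass (a, b) =
      (a powr (\<rho>1 * \<phi>1) / (\<rho>1 * \<phi>1) * (\<rho>1 powr (1 - \<phi>1) / Gamma \<phi>1)) *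
      (b powr (\<rho>2 * \<phi>2) / (\<rho>2 * \<phi>2) * (\<rho>2 powr (1 - \<phi>2) / Gamma \<phi>2))"
    by (simp add: coeff_def mass_def ac_simps)
  then show ?thesis unfolding eq by simp
qed

lemma mass_mono:
  assumes "0 \<le> fst p" "0 \<le> snd p" "fst p \<le> fst p'" "snd p \<le> snd p'"
  shows "mass p \<le> mass p'"
  unfolding mass_def using assms \<rho>1 \<rho>2 \<phi>1 \<phi>2
  by (intro mult_mono divide_right_mono powr_mono2) auto

text \<open>Dominated convergence in the level parameter, with majorant
  \<open>kern p q * B q\<close>; it gives the continuity in the level that
  \<open>fuzzy_of_ends\<close> asks for.\<close>

lemma continuous_on_kat_real:
  fixes e :: "real \<Rightarrow> real \<times> real \<Rightarrow> real"
  assumes int: "\<And>r. r \<in> S \<Longrightarrow> integrable lebesgue (\<lambda>q. kern p q * e r q)"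
    and B: "integrable lebesgue (\<lambda>q. kern p q * B q)"
    and cont: "\<And>q. q \<in> {0..fst p} \<times> {0..snd p} \<Longrightarrow> continuous_on S (\<lambda>r. e r q)"
    and le: "\<And>q r. q \<in> {0..fst p} \<times> {0..snd p} \<Longrightarrow> r \<in> S \<Longrightarrow> \<bar>e r q\<bar> \<le> B q"
  shows "continuous_on S (\<lambda>r. kat_real (e r) p)"
  unfolding continuous_on_sequentially comp_def
proof (intro allI ballI impI)
  fix X r assume r: "r \<in> S" and X: "(\<forall>n. X n \<in> S) \<and> X \<longlonglongrightarrow> r"
  have "(\<lambda>n. \<integral>q. kern p q * e (X n) q \<partial>lebesgue) \<longlonglongrightarrow> (\<integral>q. kern p q * e r q \<partial>lebesgue)"
  proof (rule integral_dominated_convergence[OF _ _ B])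
    show "AE q in lebesgue. (\<lambda>n. kern p q * e (X n) q) \<longlonglongrightarrow> kern p q * e r q"
    proof (rule AE_I2)
      fix q
      show "(\<lambda>n. kern p q * e (X n) q) \<longlonglongrightarrow> kern p q * e r q"
      proof (cases "q \<in> {0..fst p} \<times> {0..snd p}")
        case True
        then have "(\<lambda>n. e (X n) q) \<longlonglongrightarrow> e r q"
          using continuous_on_tendsto_compose[OF cont[OF True], of X r sequentially] r X by simp
        then show ?thesis by (rule tendsto_mult_left)
      qed (simp add: kern_eq_0)
    qed
    show "AE q in lebesgue. norm (kern p q * e (X n) q) \<le> kern p q * B q" for n
    proof (rule AE_I2)
      fix q
      show "norm (kern p q * e (X n) q) \<le> kern p q * B q"
      proof (cases "q \<in> {0..fst p} \<times> {0..snd p}")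
        case True
        then have "\<bar>e (X n) q\<bar> \<le> B q" using le X by blast
        then show ?thesis using kern_nonneg[of p q] by (simp add: abs_mult mult_left_mono)
      qed (simp add: kern_eq_0)
    qed
  qed (use int r X in \<open>auto intro: borel_measurable_integrable\<close>)
  then show "(\<lambda>n. kat_real (e (X n)) p) \<longlonglongrightarrow> kat_real (e r) p" by (rule tendsto_mult_left)
qed

section \<open>The fuzzy fractional integral through its endpoints\<close>

abbreviation kat_able :: "(real \<times> real \<Rightarrow> real \<Rightarrow> real) \<Rightarrow> real \<times> real \<Rightarrow> bool" where
  "kat_able g p \<equiv> kat_integrable \<rho>1 \<rho>2 \<phi>1 \<phi>2 g (fst p) (snd p)"

abbreviation kat_fuzzy :: "(real \<times> real \<Rightarrow> real \<Rightarrow> real) \<Rightarrow> real \<times> real \<Rightarrow> real \<Rightarrow> real" where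
  "kat_fuzzy g p \<equiv> kat_integral \<rho>1 \<rho>2 \<phi>1 \<phi>2 g (fst p) (snd p)"

lemma kat_integrable_iff:
  "kat_able g p \<longleftrightarrow> (\<forall>r\<in>{0..1}. integrable lebesgue (\<lambda>q. kern p q * lower_end (g q) r) \<and>
     integrable lebesgue (\<lambda>q. kern p q * upper_end (g q) r))"
  unfolding kat_integrable_def set_integrable_kern[symmetric] ..

text \<open>Integration against a nonnegative kernel preserves the order of the endpoints and their
  monotonicity in the level, and dominated convergence preserves continuity;
  \<open>fuzzy_of_ends\<close> then shows that the definite description denotes.\<close>

lemma kat_integral:
  assumes int: "kat_able g p" and g: "\<And>q. q \<in> {0..fst p} \<times> {0..snd p} \<Longrightarrow> g q \<in> fuzzy_hat"
  shows "kat_fuzzy g p \<in> fuzzy_hat"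
    and "r \<in> {0..1} \<Longrightarrow> lower_end (kat_fuzzy g p) r = kat_real (\<lambda>q. lower_end (g q) r) p"
    and "r \<in> {0..1} \<Longrightarrow> upper_end (kat_fuzzy g p) r = kat_real (\<lambda>q. upper_end (g q) r) p"
proof -
  let ?l = "\<lambda>r. kat_real (\<lambda>q. lower_end (g q) r) p" and ?u = "\<lambda>r. kat_real (\<lambda>q. upper_end (g q) r) p"
  \<comment> \<open>Level 0 contains every other level, so its endpoints bound those of all levels
    at once.\<close>
  let ?B = "\<lambda>q. \<bar>lower_end (g q) 0\<bar> + \<bar>upper_end (g q) 0\<bar>"
  note gn = fuzzy_hat_D[OF g]
  have intl: "integrable lebesgue (\<lambda>q. kern p q * lower_end (g q) r)"
    and intu: "integrable lebesgue (\<lambda>q. kern p q * upper_end (g q) r)" if "r \<in> {0..1}" for r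
    using int that unfolding kat_integrable_iff by blast+
  have "integrable lebesgue (\<lambda>q. \<bar>kern p q * lower_end (g q) 0\<bar> + \<bar>kern p q * upper_end (g q) 0\<bar>)"
    using intl[of 0] intu[of 0] by simp
  then have B: "integrable lebesgue (\<lambda>q. kern p q * ?B q)"
    by (simp add: abs_mult kern_nonneg distrib_left)
  have le: "\<bar>lower_end (g q) r\<bar> \<le> ?B q" "\<bar>upper_end (g q) r\<bar> \<le> ?B q"
    if "q \<in> {0..fst p} \<times> {0..snd p}" "r \<in> {0..1}" for q r
    using fuzzy_ends_bounds[OF gn[OF that(1)] that(2)] level_fuzzy_eq(2)[OF gn[OF that(1)] that(2)]
    by linarith+
  have "continuous_on {0..1} ?l" "continuous_on {0..1} ?u"
    using g by (intro continuous_on_kat_real[OF intl B _ le(1)] continuous_on_kat_real[OF intu B _ le(2)];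
        simp add: fuzzy_hat_iff_continuous_ends)+
  moreover have "mono_on {0..1} ?l" "antimono_on {0..1} ?u"
    by (intro monotone_onI kat_real_mono intl intu ends_mono gn; simp)+
  moreover have lu: "?l r \<le> ?u r" if "r \<in> {0..1}" for r
    by (intro kat_real_mono intl intu level_fuzzy_eq(2) gn that)
  ultimately have "\<exists>z\<in>fuzzy_hat. \<forall>r\<in>{0..1}. level z r = {?l r..?u r}"
    by (rule fuzzy_of_ends)
  then obtain z where z: "z \<in> fuzzy_hat" and "\<forall>r\<in>{0..1}. level z r = {?l r..?u r}"
    by (rule bexE)
  note level = bspec[OF this(2)]
  have "kat_fuzzy g p = z"
    unfolding kat_integral_def kat_integral_real_eq
  proof (rule the_equality)
    fix w assume w: "w \<in> fuzzy_numbers \<and> (\<forall>r\<in>{0..1}. level w r = {?l r..?u r})"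
    show "w = z"
      by (rule fuzzy_eqI) (use w fuzzy_hat_D[OF z] level in simp_all)
  qed (use fuzzy_hat_D[OF z] level in simp)
  then show "kat_fuzzy g p \<in> fuzzy_hat"
    and "r \<in> {0..1} \<Longrightarrow> lower_end (kat_fuzzy g p) r = ?l r"
    and "r \<in> {0..1} \<Longrightarrow> upper_end (kat_fuzzy g p) r = ?u r"
    using z ends_of_level[OF level lu] by auto
qed

end

section \<open>Continuous fuzzy functions\<close>

lemma limitin_fuzzy_dist:
  assumes "v \<in> \<Omega> \<rightarrow> fuzzy_hat" "p \<in> \<Omega>"
  shows "limitin (Metric_space.mtopology fuzzy_hat fuzzy_dist) v (v p) (at p within \<Omega>) \<longleftrightarrow>
    ((\<lambda>q. fuzzy_dist (v q) (v p)) \<longlongrightarrow> 0) (at p within \<Omega>)"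
proof -
  interpret E: Metric_space fuzzy_hat fuzzy_dist by (rule Metric_space_fuzzy_hat)
  have "\<forall>\<^sub>F q in at p within \<Omega>. v q \<in> fuzzy_hat"
    using assms(1) unfolding eventually_at_filter by (intro always_eventually) auto
  then have "(\<forall>\<^sub>F q in at p within \<Omega>. v q \<in> fuzzy_hat \<and> fuzzy_dist (v q) (v p) < e) \<longleftrightarrow>
      (\<forall>\<^sub>F q in at p within \<Omega>. fuzzy_dist (v q) (v p) < e)" for e
    by (simp add: eventually_conj_iff)
  then show ?thesis
    using assms by (auto simp: E.limitin_metric tendsto_iff)
qed

lemma atin_top_of_set:
  assumes "p \<in> \<Omega>"
  shows "atin (top_of_set \<Omega>) p = at p within \<Omega>"
proof (rule filter_eqI)
  fix P
  show "eventually P (atin (top_of_set \<Omega>) p) \<longleftrightarrow> eventually P (at p within \<Omega>)"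
    unfolding atin_subtopology_within[OF assms] eventually_atin_within eventually_at_topological
    by auto
qed

text \<open>Replaces continuity into an abstract metric topology by limits of real functions, to
  which a sandwich argument applies.\<close>

lemma fuzzy_cont_iff:
  "v \<in> fuzzy_cont \<Omega> \<longleftrightarrow> v \<in> \<Omega> \<rightarrow>\<^sub>E fuzzy_hat \<and>
     (\<forall>p\<in>\<Omega>. ((\<lambda>q. fuzzy_dist (v q) (v p)) \<longlongrightarrow> 0) (at p within \<Omega>))"
proof -
  have "continuous_map (top_of_set \<Omega>) (Metric_space.mtopology fuzzy_hat fuzzy_dist) v \<longleftrightarrow>
     (\<forall>p\<in>\<Omega>. ((\<lambda>q. fuzzy_dist (v q) (v p)) \<longlongrightarrow> 0) (at p within \<Omega>))" if "v \<in> \<Omega> \<rightarrow>\<^sub>E fuzzy_hat"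
    unfolding continuous_map_atin topspace_euclidean_subtopology
    using that by (intro ball_cong refl) (auto simp: atin_top_of_set limitin_fuzzy_dist PiE_iff)
  then show ?thesis by (auto simp: fuzzy_cont_def)
qed

abbreviation "fuzzy_hat_metric \<equiv> metric (fuzzy_hat, fuzzy_dist)"

lemma fuzzy_hat_metric [simp]:
  "mspace fuzzy_hat_metric = fuzzy_hat" "mdist fuzzy_hat_metric = fuzzy_dist"
  by (simp_all add: Metric_space.mspace_metric Metric_space.mdist_metric Metric_space_fuzzy_hat)

text \<open>On a compact domain continuity forces boundedness, so the bounded continuous functions
  with the supremum metric are exactly the intended space.\<close>

lemma mspace_fuzzy_cont:
  assumes "compact \<Omega>"
  shows "mspace (cfunspace (top_of_set \<Omega>) fuzzy_hat_metric) = fuzzy_cont \<Omega>"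
proof -
  have "compactin (top_of_set \<Omega>) (topspace (top_of_set \<Omega>))"
    using assms by (simp add: compactin_subtopology)
  from compactin_mspace_cfunspace[OF this, of fuzzy_hat_metric] show ?thesis
    by (auto simp: fuzzy_cont_def mtopology_of_def PiE_def extensional_def)
qed

lemma fuzzy_cont_bounded_dist:
  assumes "compact \<Omega>" "v \<in> fuzzy_cont \<Omega>" "v' \<in> fuzzy_cont \<Omega>"
  obtains M where "0 \<le> M" "\<And>p. p \<in> \<Omega> \<Longrightarrow> fuzzy_dist (v p) (v' p) \<le> M"
proof -
  obtain B where "\<And>p. p \<in> \<Omega> \<Longrightarrow> fuzzy_dist (v p) (v' p) \<le> B"
    using cfunspace_imp_bounded2[of v "top_of_set \<Omega>" fuzzy_hat_metric v'] assms
    unfolding mspace_fuzzy_cont[OF assms(1)] by auto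
  then show thesis using that[of "max 0 B"] by (meson max.cobounded1 max.coboundedI2)
qed

text \<open>Banach's theorem for the supremum metric. The contraction hypothesis is phrased with
  pointwise bounds \<open>M\<close>, so an application never has to mention that metric.\<close>

lemma fuzzy_cont_unique_fixpoint:
  assumes \<Omega>: "compact \<Omega>" "\<Omega> \<noteq> {}" and ne: "fuzzy_cont \<Omega> \<noteq> {}" and T: "T \<in> fuzzy_cont \<Omega> \<rightarrow> fuzzy_cont \<Omega>"
    and k: "0 \<le> k" "k < 1"
    and contr: "\<And>v v' M p. v \<in> fuzzy_cont \<Omega> \<Longrightarrow> v' \<in> fuzzy_cont \<Omega> \<Longrightarrow>
      (\<And>q. q \<in> \<Omega> \<Longrightarrow> fuzzy_dist (v q) (v' q) \<le> M) \<Longrightarrow> p \<in> \<Omega> \<Longrightarrow> fuzzy_dist (T v p) (T v' p) \<le> k * M"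
  shows "\<exists>!v. v \<in> fuzzy_cont \<Omega> \<and> T v = v"
proof -
  let ?C = "cfunspace (top_of_set \<Omega>) fuzzy_hat_metric"
  interpret E: Metric_space fuzzy_hat fuzzy_dist by (rule Metric_space_fuzzy_hat)
  interpret C: Metric_space "mspace ?C" "mdist ?C" by (rule Metric_space_mspace_mdist)
  note ms = mspace_fuzzy_cont[OF \<Omega>(1)]
  have complete: "C.mcomplete"
    using E.mcomplete_cfunspace[OF mcomplete_fuzzy_hat, of "top_of_set \<Omega>"]
    by (simp add: mcomplete_of_def E.Self_def)
  have "mdist ?C (T v) (T v') \<le> k * mdist ?C v v'" if v: "v \<in> mspace ?C" "v' \<in> mspace ?C" for v v'
  proof -
    have v': "v \<in> fuzzy_cont \<Omega>" "v' \<in> fuzzy_cont \<Omega>" using v ms by auto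
    have T': "T v \<in> mspace ?C" "T v' \<in> mspace ?C" using v' T ms by auto
    \<comment> \<open>\<open>cfunspace_mdist_le\<close> serves in both directions: the supremum
      distance is an admissible \<open>M\<close>, and the pointwise bound from \<open>contr\<close>
      passes back to the supremum.\<close>
    have "fuzzy_dist (v q) (v' q) \<le> mdist ?C v v'" if "q \<in> \<Omega>" for q
      using cfunspace_mdist_le[OF v, of "mdist ?C v v'"] that by force
    from contr[OF v' this] show ?thesis
      using cfunspace_mdist_le[OF T', of "k * mdist ?C v v'"] \<Omega>(2) by simp
  qed
  note contr' = this
  have TC: "T \<in> mspace ?C \<rightarrow> mspace ?C" using T ms by simp
  obtain v where v: "v \<in> mspace ?C" "T v = v"
    using C.Banach_fixedpoint_thm[OF complete _ TC k(2) contr'] ne ms by metis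
  show ?thesis
  proof (rule ex1I[of _ v])
    show "v \<in> fuzzy_cont \<Omega> \<and> T v = v" using v unfolding ms by simp
    show "w = v" if "w \<in> fuzzy_cont \<Omega> \<and> T w = w" for w
      using C.contraction_imp_unique_fixpoint[OF _ v(2) TC k(2) contr'] that v(1)
      unfolding ms by blast
  qed
qed

section \<open>The integral equation\<close>

text \<open>The Lipschitz condition acts in the last argument of \<open>F\<close> only and gives no
  regularity in \<open>(x, y)\<close>. Existence of the integrals is therefore the assumption
  \<open>integral_defined\<close>, and continuity of the right-hand side at one \<open>v0\<close> is
  \<open>rhs_continuous\<close>. The latter is necessary for existence, since a solution can itself
  serve as \<open>v0\<close>.\<close>

theorem theorem3p5:
  fixes a b \<rho>1 \<rho>2 \<phi>1 \<phi>2 R :: real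
    and F :: "real \<Rightarrow> real \<Rightarrow> (real \<Rightarrow> real) \<Rightarrow> real \<Rightarrow> real"
    and \<xi>1 \<xi>2 :: "real \<Rightarrow> real \<Rightarrow> real"
  defines "\<Omega> \<equiv> {0..a} \<times> {0..b}"
    and "h \<equiv> \<lambda>x y. fuzzy_add (\<xi>1 x) (hdiff (\<xi>2 y) (\<xi>1 0))"
    and "frac_int \<equiv> \<lambda>v x y.
           kat_integral \<rho>1 \<rho>2 \<phi>1 \<phi>2 (\<lambda>(s, t). F s t (v (s, t))) x y"
  assumes "a > 0" "b > 0" "\<rho>1 > 0" "\<rho>2 > 0"
    and "0 < \<phi>1" "\<phi>1 \<le> 1" "0 < \<phi>2" "\<phi>2 \<le> 1"
    and F_maps: "\<And>x y u. (x, y) \<in> \<Omega> \<Longrightarrow> u \<in> fuzzy_hat \<Longrightarrow> F x y u \<in> fuzzy_hat"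
    and xi1: "\<And>x. x \<in> {0..a} \<Longrightarrow> \<xi>1 x \<in> fuzzy_hat"
    and xi2: "\<And>y. y \<in> {0..b} \<Longrightarrow> \<xi>2 y \<in> fuzzy_hat"
    and h_defined: "\<And>y. y \<in> {0..b} \<Longrightarrow> hdiff_exists (\<xi>2 y) (\<xi>1 0)"
    and integral_defined: "\<And>v x y. v \<in> fuzzy_cont \<Omega> \<Longrightarrow> (x, y) \<in> \<Omega> \<Longrightarrow>
           kat_integrable \<rho>1 \<rho>2 \<phi>1 \<phi>2 (\<lambda>(s, t). F s t (v (s, t))) x y"
    and rhs_continuous: "\<exists>v0\<in>fuzzy_cont \<Omega>.
           (\<lambda>(x, y)\<in>\<Omega>. fuzzy_add (h x y) (frac_int v0 x y)) \<in> fuzzy_cont \<Omega>"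
    and "R > 0"
    and Lipschitz: "\<And>v v' x y. v \<in> fuzzy_cont \<Omega> \<Longrightarrow> v' \<in> fuzzy_cont \<Omega> \<Longrightarrow> (x, y) \<in> \<Omega> \<Longrightarrow>
           fuzzy_dist (F x y (v (x, y))) (F x y (v' (x, y)))
             \<le> R * fuzzy_dist (v (x, y)) (v' (x, y))"
    and Xi: "R / (Gamma (\<phi>1 + 1) * Gamma (\<phi>2 + 1)) *
           (a powr \<rho>1 / \<rho>1) powr \<phi>1 * (b powr \<rho>2 / \<rho>2) powr \<phi>2 < 1"
  shows "\<exists>!v. v \<in> fuzzy_cont \<Omega> \<and>
           (\<forall>x y. (x, y) \<in> \<Omega> \<longrightarrow> v (x, y) = fuzzy_add (h x y) (frac_int v x y))"
proof -
  interpret katugampola \<rho>1 \<rho>2 \<phi>1 \<phi>2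
    using \<open>\<rho>1 > 0\<close> \<open>\<rho>2 > 0\<close> \<open>0 < \<phi>1\<close> \<open>0 < \<phi>2\<close> by unfold_locales
  interpret E: Metric_space fuzzy_hat fuzzy_dist by (rule Metric_space_fuzzy_hat)

  \<comment> \<open>The operator and its endpoint functions\<close>
  define G where "G v q = F (fst q) (snd q) (v q)" for v q
  define H where "H p = h (fst p) (snd p)" for p
  \<comment> \<open>The restriction to \<open>\<Omega>\<close> makes \<open>T v\<close> extensional,
    as elements of \<open>fuzzy_cont \<Omega>\<close> are.\<close>
  define T where "T v = (\<lambda>p\<in>\<Omega>. fuzzy_add (H p) (kat_fuzzy (G v) p))" for v
  \<comment> \<open>The constant \<Xi> in the form in which the kernel estimates produce it.\<close>
  define k where "k = coeff * mass (a, b) * R"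
  have compact: "compact \<Omega>" by (simp add: \<Omega>_def compact_Times)
  have ne: "\<Omega> \<noteq> {}" using \<open>a > 0\<close> \<open>b > 0\<close> by (auto simp: \<Omega>_def)
  have nonneg: "0 \<le> fst p" "0 \<le> snd p" if "p \<in> \<Omega>" for p using that by (auto simp: \<Omega>_def)
  have rect: "{0..fst p} \<times> {0..snd p} \<subseteq> \<Omega>" if "p \<in> \<Omega>" for p using that by (auto simp: \<Omega>_def)
  have H: "H p \<in> fuzzy_hat" if "p \<in> \<Omega>" for p
    unfolding H_def h_def
    by (intro fuzzy_add(1) hdiff_in_fuzzy_hat xi1 h_defined)
      (use that \<open>a > 0\<close> in \<open>auto simp: \<Omega>_def\<close>)
  have v_hat: "v p \<in> fuzzy_hat" if "v \<in> fuzzy_cont \<Omega>" "p \<in> \<Omega>" for v p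
    using that by (auto simp: fuzzy_cont_def)
  have G: "G v p \<in> fuzzy_hat" if "v \<in> fuzzy_cont \<Omega>" "p \<in> \<Omega>" for v p
    using F_maps[OF _ v_hat[OF that]] that(2) by (simp add: G_def)
  have G_eq: "(\<lambda>(s, t). F s t (v (s, t))) = G v" for v by (auto simp: G_def)
  have G_int: "kat_able (G v) p" if "v \<in> fuzzy_cont \<Omega>" "p \<in> \<Omega>" for v p
    using integral_defined[OF that(1), of "fst p" "snd p"] that(2) by (simp add: G_eq)
  note kat_fuzzy = kat_integral[OF G_int G[OF _ subsetD[OF rect]]]
  have T: "T v p \<in> fuzzy_hat" if "v \<in> fuzzy_cont \<Omega>" "p \<in> \<Omega>" for v p
    using fuzzy_add(1)[OF H kat_fuzzy(1)] that by (simp add: T_def)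
  have T_lower: "lower_end (T v p) r = lower_end (H p) r + kat_real (\<lambda>q. lower_end (G v q) r) p"
    and T_upper: "upper_end (T v p) r = upper_end (H p) r + kat_real (\<lambda>q. upper_end (G v q) r) p"
    if "v \<in> fuzzy_cont \<Omega>" "p \<in> \<Omega>" "r \<in> {0..1}" for v p r
    using fuzzy_add(2,3)[OF H kat_fuzzy(1)] kat_fuzzy(2,3) that by (simp_all add: T_def)
  have int: "integrable lebesgue (\<lambda>q. kern p q * lower_end (G v q) r)"
    "integrable lebesgue (\<lambda>q. kern p q * upper_end (G v q) r)"
    if "v \<in> fuzzy_cont \<Omega>" "p \<in> \<Omega>" "r \<in> {0..1}" for v p r
    using G_int[OF that(1,2)] that(3) unfolding kat_integrable_iff by blast+
  have G_diff: "\<bar>lower_end (G v q) r - lower_end (G v' q) r\<bar> \<le> R * M"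
    "\<bar>upper_end (G v q) r - upper_end (G v' q) r\<bar> \<le> R * M"
    if v: "v \<in> fuzzy_cont \<Omega>" "v' \<in> fuzzy_cont \<Omega>" and M: "fuzzy_dist (v q) (v' q) \<le> M"
      and q: "q \<in> \<Omega>" and r: "r \<in> {0..1}" for v v' q r M
  proof -
    have "fuzzy_dist (G v q) (G v' q) \<le> R * fuzzy_dist (v q) (v' q)"
      using Lipschitz[OF v, of "fst q" "snd q"] q by (simp add: G_def)
    also have "\<dots> \<le> R * M" using M \<open>R > 0\<close> by simp
    finally have "fuzzy_dist (G v q) (G v' q) \<le> R * M" .
    with abs_ends_diff_le[OF fuzzy_hat_D[OF G[OF v(1) q]] fuzzy_hat_D[OF G[OF v(2) q]] r]
    show "\<bar>lower_end (G v q) r - lower_end (G v' q) r\<bar> \<le> R * M"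
      "\<bar>upper_end (G v q) r - upper_end (G v' q) r\<bar> \<le> R * M" by linarith+
  qed

  \<comment> \<open>The contraction estimate\<close>
  have contr: "fuzzy_dist (T v p) (T v' p) \<le> k * M"
    if v: "v \<in> fuzzy_cont \<Omega>" "v' \<in> fuzzy_cont \<Omega>"
      and M: "\<And>q. q \<in> \<Omega> \<Longrightarrow> fuzzy_dist (v q) (v' q) \<le> M" and p: "p \<in> \<Omega>" for v v' M p
  proof -
    note p0 = nonneg[OF p]
    have "0 \<le> M" using M[OF p] E.nonneg[of "v p" "v' p"] by linarith
    \<comment> \<open>The mass is largest at the corner \<open>(a, b)\<close>, which makes the
      factor independent of \<open>p\<close>.\<close>
    moreover have "coeff * mass p \<le> coeff * mass (a, b)"
      using p by (intro mult_left_mono mass_mono coeff_nonneg) (auto simp: \<Omega>_def)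
    ultimately have k: "coeff * mass p * (R * M) \<le> k * M"
      using \<open>R > 0\<close> unfolding k_def mult.assoc[symmetric]
      by (intro mult_right_mono) auto
    show ?thesis
      unfolding fuzzy_dist_le_iff[OF fuzzy_hat_D[OF T[OF v(1) p]] fuzzy_hat_D[OF T[OF v(2) p]]]
    proof (intro ballI conjI)
      fix r :: real assume r: "r \<in> {0..1}"
      note D = G_diff[OF v M[OF subsetD[OF rect[OF p]]] subsetD[OF rect[OF p]] r]
      note I = int[OF v(1) p r] int[OF v(2) p r]
      show "\<bar>lower_end (T v p) r - lower_end (T v' p) r\<bar> \<le> k * M"
        unfolding T_lower[OF v(1) p r] T_lower[OF v(2) p r]
        using kat_real_diff_le[OF p0 I(1,3) D(1)] k by simp
      show "\<bar>upper_end (T v p) r - upper_end (T v' p) r\<bar> \<le> k * M"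
        unfolding T_upper[OF v(1) p r] T_upper[OF v(2) p r]
        using kat_real_diff_le[OF p0 I(2,4) D(2)] k by simp
    qed
  qed

  \<comment> \<open>Continuity is transferred from one function to all\<close>
  have modulus: "fuzzy_dist (T v p') (T v p) \<le> fuzzy_dist (T v' p') (T v' p) +
      coeff * (R * M) * (\<integral>q. \<bar>kern p' q - kern p q\<bar> \<partial>lebesgue)"
    if v: "v \<in> fuzzy_cont \<Omega>" "v' \<in> fuzzy_cont \<Omega>"
      and M: "\<And>q. q \<in> \<Omega> \<Longrightarrow> fuzzy_dist (v q) (v' q) \<le> M" and p: "p \<in> \<Omega>" "p' \<in> \<Omega>" for v v' M p p'
    unfolding fuzzy_dist_le_iff[OF fuzzy_hat_D[OF T[OF v(1) p(2)]] fuzzy_hat_D[OF T[OF v(1) p(1)]]]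
  proof (intro ballI conjI)
    fix r :: real assume r: "r \<in> {0..1}"
    have sub: "{0..fst p'} \<times> {0..snd p'} \<union> {0..fst p} \<times> {0..snd p} \<subseteq> \<Omega>"
      using rect[OF p(1)] rect[OF p(2)] by blast
    note D = G_diff[OF v M[OF subsetD[OF sub]] subsetD[OF sub] r]
    note I = int[OF v(1) p(2) r] int[OF v(1) p(1) r] int[OF v(2) p(2) r] int[OF v(2) p(1) r]
    note T0 = abs_ends_diff_le[OF fuzzy_hat_D[OF T[OF v(2) p(2)]] fuzzy_hat_D[OF T[OF v(2) p(1)]] r]
    \<comment> \<open>In the second difference of \<open>T v\<close> and \<open>T v'\<close> the
      term \<open>H\<close> cancels, so the regularity of \<open>h\<close> enters only through
      \<open>T v'\<close>.\<close>
    show "\<bar>lower_end (T v p') r - lower_end (T v p) r\<bar> \<le> fuzzy_dist (T v' p') (T v' p) +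
        coeff * (R * M) * (\<integral>q. \<bar>kern p' q - kern p q\<bar> \<partial>lebesgue)"
      using kat_real_diff_modulus[OF nonneg[OF p(2)] nonneg[OF p(1)] I(1,3,5,7) D(1)] T0(1)
      unfolding T_lower[OF v(1) p(2) r] T_lower[OF v(1) p(1) r]
        T_lower[OF v(2) p(2) r] T_lower[OF v(2) p(1) r]
      by linarith
    show "\<bar>upper_end (T v p') r - upper_end (T v p) r\<bar> \<le> fuzzy_dist (T v' p') (T v' p) +
        coeff * (R * M) * (\<integral>q. \<bar>kern p' q - kern p q\<bar> \<partial>lebesgue)"
      using kat_real_diff_modulus[OF nonneg[OF p(2)] nonneg[OF p(1)] I(2,4,6,8) D(2)] T0(2)
      unfolding T_upper[OF v(1) p(2) r] T_upper[OF v(1) p(1) r]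
        T_upper[OF v(2) p(2) r] T_upper[OF v(2) p(1) r]
      by linarith
  qed
  have T_eq: "(\<lambda>(x, y)\<in>\<Omega>. fuzzy_add (h x y) (frac_int v x y)) = T v" for v
    by (auto simp: T_def H_def frac_int_def G_eq)
  obtain v0 where v0: "v0 \<in> fuzzy_cont \<Omega>" and Tv0: "T v0 \<in> fuzzy_cont \<Omega>"
    using rhs_continuous unfolding T_eq by blast
  have T_cont: "T v \<in> fuzzy_cont \<Omega>" if v: "v \<in> fuzzy_cont \<Omega>" for v
    unfolding fuzzy_cont_iff
  proof (intro conjI ballI)
    show "T v \<in> \<Omega> \<rightarrow>\<^sub>E fuzzy_hat" using T[OF v] by (auto simp: T_def)
    fix p assume p: "p \<in> \<Omega>"
    obtain M where M: "0 \<le> M" "\<And>q. q \<in> \<Omega> \<Longrightarrow> fuzzy_dist (v q) (v0 q) \<le> M"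
      using fuzzy_cont_bounded_dist[OF compact v v0] by blast
    let ?J = "\<lambda>p'. \<integral>q. \<bar>kern p' q - kern p q\<bar> \<partial>lebesgue"
    have "(?J \<longlongrightarrow> 0) (at p within \<Omega>)"
      \<comment> \<open>\<open>kern_tendsto_L1\<close> is a statement about sequences, so the limit
        is passed to sequences in \<open>\<Omega>\<close>.\<close>
      unfolding tendsto_at_iff_sequentially comp_def
    proof (intro allI impI kern_tendsto_L1)
      have "\<Omega> \<subseteq> {0..} \<times> {0..}" by (auto simp: \<Omega>_def)
      then show "p \<in> {0..} \<times> {0..}" and "X n \<in> {0..} \<times> {0..}" if "\<forall>i. X i \<in> \<Omega> - {p}" for X n
        using that p by blast+
    qed
    moreover have "((\<lambda>p'. fuzzy_dist (T v0 p') (T v0 p)) \<longlongrightarrow> 0) (at p within \<Omega>)"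
      using Tv0 p unfolding fuzzy_cont_iff by blast
    ultimately have "((\<lambda>p'. fuzzy_dist (T v0 p') (T v0 p) + coeff * (R * M) * ?J p') \<longlongrightarrow> 0) (at p within \<Omega>)"
      by (auto intro!: tendsto_eq_intros)
    then show "((\<lambda>p'. fuzzy_dist (T v p') (T v p)) \<longlongrightarrow> 0) (at p within \<Omega>)"
    proof (rule tendsto_sandwich[OF _ _ tendsto_const, rotated 2])
      show "\<forall>\<^sub>F p' in at p within \<Omega>. 0 \<le> fuzzy_dist (T v p') (T v p)" by simp
      show "\<forall>\<^sub>F p' in at p within \<Omega>. fuzzy_dist (T v p') (T v p) \<le>
          fuzzy_dist (T v0 p') (T v0 p) + coeff * (R * M) * ?J p'"
        unfolding eventually_at_filter
        by (intro always_eventually allI impI modulus v v0 M(2) p)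
    qed
  qed

  \<comment> \<open>The fixed point and the integral equation\<close>
  have "k = R / (Gamma (\<phi>1 + 1) * Gamma (\<phi>2 + 1)) *
      (a powr \<rho>1 / \<rho>1) powr \<phi>1 * (b powr \<rho>2 / \<rho>2) powr \<phi>2"
    using coeff_mass[of a b] \<open>a > 0\<close> \<open>b > 0\<close> by (simp add: k_def)
  with Xi have k1: "k < 1" by simp
  have k0: "0 \<le> k" using coeff_nonneg mass_nonneg \<open>R > 0\<close> by (simp add: k_def)
  have "\<exists>!v. v \<in> fuzzy_cont \<Omega> \<and> T v = v"
  proof (rule fuzzy_cont_unique_fixpoint[OF compact ne _ _ k0 k1])
    show "fuzzy_cont \<Omega> \<noteq> {}" using v0 by blast
    show "T \<in> fuzzy_cont \<Omega> \<rightarrow> fuzzy_cont \<Omega>" using T_cont by blast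
  qed (rule contr)
  \<comment> \<open>Both \<open>v\<close> and \<open>T v\<close> are extensional, so the pointwise
    equation on \<open>\<Omega>\<close> is the same as equality of functions.\<close>
  moreover have "T v = v \<longleftrightarrow> (\<forall>x y. (x, y) \<in> \<Omega> \<longrightarrow> v (x, y) = fuzzy_add (h x y) (frac_int v x y))"
    if v: "v \<in> fuzzy_cont \<Omega>" for v
  proof -
    have "v \<in> extensional \<Omega>" "T v \<in> extensional \<Omega>"
      using v T_cont[OF v] by (auto simp: fuzzy_cont_def PiE_def)
    then have "T v = v \<longleftrightarrow> (\<forall>p\<in>\<Omega>. T v p = v p)" by (auto intro: extensionalityI)
    also have "\<dots> \<longleftrightarrow> (\<forall>x y. (x, y) \<in> \<Omega> \<longrightarrow> v (x, y) = fuzzy_add (h x y) (frac_int v x y))"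
      by (auto simp: T_eq[symmetric])
    finally show ?thesis .
  qed
  ultimately show ?thesis by (simp cong: conj_cong)
qed

end
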